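(* There exists a group homomorphism $\rho:\mathrm{SL}(2,\mathbf Z)\to\mathcal A^\times$ with the following properties. (a) The $\mathbf C\,\mathrm{SL}(2,\mathbf Z)$-module $E$ (with $Y$ acting on $E$ by left multiplication by $\rho(Y)$ in the basis $\{e_n\}$) has an ascending filtration $0=E_0\subset E_1\subset E_2\subset\cdots$ by $\mathbf C\,\mathrm{SL}(2,\mathbf Z)$-submodules such that for each $i\in\mathbf N$ the quotient $E_i/E_{i-1}$ is isomorphic to the standard $2$-dimensional $\mathbf C\,\mathrm{SL}(2,\mathbf Z)$-module. (b) $\rho(T)=D$. (c) $\rho(Y)$ is an integer matrix for every $Y\in\mathrm{SL}(2,\mathbf Z)$. (d) $\rho(\mathrm{SL}(2,\mathbf Z))\subseteq\mathcal{DR}_0$.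
   Context: $\mathbf N=\{1,2,\dots\}$. $E$ is the complex vector space with basis $\{e_n\}_{n\in\mathbf N}$; $\mathcal A$ is the ring of matrices $(a_{i,j})_{i,j\in\mathbf N}$ with complex entries such that each column has only finitely many nonzero entries (these are exactly the endomorphisms of $E$ acting on the left), and $\mathcal A^\times$ its group of units. $T=\begin{pmatrix}1&1\\0&1\end{pmatrix}\in\mathrm{SL}(2,\mathbf Z)$. The divisor matrix is $D=(d_{i,j})_{i,j\in\mathbf N}$ with $d_{i,j}=1$ if $i$ divides $j$ and $d_{i,j}=0$ otherwise. $\mathcal{DR}_0$ denotes the set of matrices $A=(a_{i,j})\in\mathcal A$ for which there exist positive constants $C,c$ (depending on $A$) such that $a_{i,j}=0$ whenever $i>Cj^c$ and $|a_{i,j}|\le Cj^c$ for all $i,j$. *)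

theory Defs
  imports "HOL-Analysis.Analysis"
begin

text \<open>Infinite matrices indexed by N = {1,2,...}, modelled as functions nat => nat => complex
  that vanish whenever a row or column index is 0 (index 0 is unused).\<close>
type_synonym imat = "nat \<Rightarrow> nat \<Rightarrow> complex"
type_synonym ivec = "nat \<Rightarrow> complex"

definition colfin :: "imat set" where
  "colfin = {M. (\<forall>i j. (i = 0 \<or> j = 0) \<longrightarrow> M i j = 0) \<and> (\<forall>j. finite {i. M i j \<noteq> 0})}"

definition imat_mult :: "imat \<Rightarrow> imat \<Rightarrow> imat" where
  "imat_mult A B = (\<lambda>i j. \<Sum>k\<in>{k. B k j \<noteq> 0}. A i k * B k j)"

definition imat_one :: imat where
  "imat_one = (\<lambda>i j. if i = j \<and> 1 \<le> i then 1 else 0)"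

definition colfin_units :: "imat set" where
  "colfin_units = {M \<in> colfin. \<exists>N\<in>colfin. imat_mult M N = imat_one \<and> imat_mult N M = imat_one}"

definition Espace :: "ivec set" where
  "Espace = {v. v 0 = 0 \<and> finite {n. v n \<noteq> 0}}"

definition imat_act :: "imat \<Rightarrow> ivec \<Rightarrow> ivec" where
  "imat_act M v = (\<lambda>i. \<Sum>j\<in>{j. v j \<noteq> 0}. M i j * v j)"

definition SL2Z :: "(int^2^2) set" where
  "SL2Z = {Y. det Y = 1}"

definition Tmat :: "int^2^2" where
  "Tmat = (\<chi> i j. if i = 2 \<and> j = 1 then 0 else 1)"

definition cmat :: "int^2^2 \<Rightarrow> complex^2^2" where
  "cmat Y = (\<chi> i j. of_int (Y $ i $ j))"

definition divisor_matrix :: imat where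
  "divisor_matrix = (\<lambda>i j. if 1 \<le> i \<and> 1 \<le> j \<and> i dvd j then 1 else 0)"

definition DR0 :: "imat set" where
  "DR0 = {M \<in> colfin. \<exists>C c. C > 0 \<and> c > 0 \<and>
     (\<forall>i\<ge>1. \<forall>j\<ge>1. (real i > C * real j powr c \<longrightarrow> M i j = 0) \<and>
                     norm (M i j) \<le> C * real j powr c)}"

definition submodule :: "(int^2^2 \<Rightarrow> imat) \<Rightarrow> ivec set \<Rightarrow> bool" where
  "submodule \<rho> S \<longleftrightarrow> S \<subseteq> Espace \<and> (\<lambda>n. 0) \<in> S \<and>
     (\<forall>u\<in>S. \<forall>v\<in>S. (\<lambda>n. u n + v n) \<in> S) \<and> (\<forall>a. \<forall>v\<in>S. (\<lambda>n. a * v n) \<in> S) \<and>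
     (\<forall>Y\<in>SL2Z. \<forall>v\<in>S. imat_act (\<rho> Y) v \<in> S)"

text \<open>The quotient F/G (G a submodule contained in F) is isomorphic to the standard module:
  there is a C-linear surjective SL(2,Z)-equivariant map F -> C^2 with kernel exactly G.\<close>
definition quotient_is_standard :: "(int^2^2 \<Rightarrow> imat) \<Rightarrow> ivec set \<Rightarrow> ivec set \<Rightarrow> bool" where
  "quotient_is_standard \<rho> F G \<longleftrightarrow> G \<subseteq> F \<and> (\<exists>\<phi> :: ivec \<Rightarrow> complex^2.
     (\<forall>u\<in>F. \<forall>v\<in>F. \<phi> (\<lambda>n. u n + v n) = \<phi> u + \<phi> v) \<and>
     (\<forall>a. \<forall>v\<in>F. \<phi> (\<lambda>n. a * v n) = a *s \<phi> v) \<and>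
     \<phi> ` F = UNIV \<and> {v\<in>F. \<phi> v = 0} = G \<and>
     (\<forall>Y\<in>SL2Z. \<forall>v\<in>F. \<phi> (imat_act (\<rho> Y) v) = cmat Y *v \<phi> v))"

end

theory Submission
  imports Defs
begin

text \<open>
Identify row vectors with formal Dirichlet series, so that \<open>D\<close> becomes multiplication by
\<open>\<zeta> = 1 + x\<close>. Put \<open>y = x\<^sup>2 / \<zeta>\<close>. The series \<open>m\<^sup>-\<^sup>s y\<^sup>k\<close> and \<open>m\<^sup>-\<^sup>s y\<^sup>k x\<close> (\<open>m\<close> odd) form a unitriangular
basis, and since \<open>\<zeta> x = y + (1 + y) x\<close>, in this basis \<open>D\<close> acts on each block as
\<open>T = (1, 1; y, 1 + y)\<close> over \<open>\<int>[[y]]\<close>, a matrix of determinant \<open>1\<close> and trace \<open>2 + y\<close>. If \<open>c\<close> is the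
power series with \<open>c (1 + y c) = 1\<close> (Catalan numbers with signs), then \<open>S = (0, -c; 1 + y c, 0)\<close>
satisfies \<open>S\<^sup>2 = -1\<close>, and \<open>S T\<close> has determinant and trace \<open>1\<close>, so \<open>(S T)\<^sup>3 = -1\<close>: this is a
representation of the modular group reducing modulo \<open>y\<close> to the standard one, and the powers of
\<open>y\<close> give the filtration. Both changes of basis have polynomially bounded entries; for the one back
this uses that \<open>2\<^sup>-\<^sup>s = 1 - \<lambda> / \<zeta>\<close> with \<open>\<lambda>\<close> the sum of \<open>m\<^sup>-\<^sup>s\<close> over odd \<open>m\<close>.
\<close>

section \<open>The modular group\<close>

lemma vec2_eq_iff: "(A::'a^2^2) = B \<longleftrightarrow> A$1$1 = B$1$1 \<and> A$1$2 = B$1$2 \<and> A$2$1 = B$2$1 \<and> A$2$2 = B$2$2"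
  by (auto simp: vec_eq_iff forall_2)

lemma matrix_mult_2_nth: "((A::'a::semiring_1^2^2) ** B) $ i $ j = A$i$1 * B$1$j + A$i$2 * B$2$j"
  by (simp add: matrix_matrix_mult_def sum_2)

lemma mat_1_2_nth: "(mat 1 :: 'a::semiring_1^2^2)$1$1 = 1" "(mat 1 :: 'a^2^2)$1$2 = 0"
   "(mat 1 :: 'a^2^2)$2$1 = 0" "(mat 1 :: 'a^2^2)$2$2 = 1"
  by (auto simp: mat_def)

definition mat2 :: "'a \<Rightarrow> 'a \<Rightarrow> 'a \<Rightarrow> 'a \<Rightarrow> 'a^2^2" where
  "mat2 a b c d = (\<chi> i j. if i = 1 then (if j = 1 then a else b) else (if j = 1 then c else d))"

lemma mat2_nth [simp]: "mat2 a b c d $ 1 $ 1 = a" "mat2 a b c d $ 1 $ 2 = b"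
   "mat2 a b c d $ 2 $ 1 = c" "mat2 a b c d $ 2 $ 2 = d"
  by (auto simp: mat2_def)

lemmas mat2_simps = vec2_eq_iff matrix_mult_2_nth mat_1_2_nth

abbreviation Smat :: "int^2^2" where "Smat \<equiv> mat2 0 (-1) 1 0"
abbreviation Umat :: "int^2^2" where "Umat \<equiv> mat2 0 (-1) 1 1"

lemma Tmat_eq: "Tmat = mat2 1 1 0 1"
  by (simp add: vec2_eq_iff Tmat_def)

lemma matrix_mult_minus_left: "(- A :: 'a::ring_1^'n^'m) ** B = - (A ** B)"
  by (simp add: matrix_matrix_mult_def vec_eq_iff sum_negf)

lemma matrix_mult_minus_right: "(A :: 'a::ring_1^'n^'m) ** (- B) = - (A ** B)"
  by (simp add: matrix_matrix_mult_def vec_eq_iff sum_negf)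

lemmas matrix_minus_simps = matrix_mult_minus_left matrix_mult_minus_right

text \<open>The graph of the representation sending the generators to \<open>s\<close> and \<open>u\<close>; that it is the
  graph of a function is the presentation of the modular group.\<close>
inductive words :: "'a::comm_ring_1^'n^'n \<Rightarrow> 'a^'n^'n \<Rightarrow> int^2^2 \<Rightarrow> 'a^'n^'n \<Rightarrow> bool" for s u where
  one: "words s u (mat 1) (mat 1)"
| S: "words s u Y h \<Longrightarrow> words s u (Smat ** Y) (s ** h)"
| U: "words s u Y h \<Longrightarrow> words s u (Umat ** Y) (u ** h)"

text \<open>Products of the blocks \<open>- S U\<close> and \<open>- S U\<^sup>2\<close>, closed on
  the right by nothing or by one \<open>S\<close>. A nonempty word starts with \<open>S\<close>;
  leading powers of \<open>U\<close> are left to \<open>normal_words\<close>. In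
  \<open>alt_words_entries\<close> the first sign pattern belongs to the words without final
  \<open>S\<close>, the second to those with it.\<close>

inductive alt_words :: "'a::comm_ring_1^'n^'n \<Rightarrow> 'a^'n^'n \<Rightarrow> int^2^2 \<Rightarrow> 'a^'n^'n \<Rightarrow> bool" for s u where
  one: "alt_words s u (mat 1) (mat 1)"
| S: "alt_words s u Smat s"
| SU: "alt_words s u Y h \<Longrightarrow> alt_words s u (- (Smat ** (Umat ** Y))) (- (s ** (u ** h)))"
| SUU: "alt_words s u Y h \<Longrightarrow>
    alt_words s u (- (Smat ** (Umat ** (Umat ** Y)))) (- (s ** (u ** (u ** h))))"

text \<open>Both \<open>- S U\<close> and \<open>- S U\<^sup>2\<close> are elementary matrices with nonnegative entries, so a product of
  them can only be trivial if it is empty.\<close>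
lemma alt_words_entries:
  assumes "alt_words s u Y h"
  shows "Y$1$1 \<ge> 1 \<and> Y$2$2 \<ge> 1 \<and> Y$1$2 \<ge> 0 \<and> Y$2$1 \<ge> 0 \<and> (Y$1$2 = 0 \<and> Y$2$1 = 0 \<longrightarrow> h = mat 1)
       \<or> Y$1$2 \<le> -1 \<and> Y$2$1 \<ge> 1 \<and> Y$1$1 \<ge> 0 \<and> Y$2$2 \<le> 0"
  using assms by induction (auto simp: mat2_simps)

text \<open>The six prefixes are the powers of \<open>U\<close>, since
  \<open>U\<^sup>3 = -1\<close>. Up to sign these are the normal forms in the free product of cyclic
  groups of orders 2 and 3.\<close>

definition normal_words :: "'a::comm_ring_1^'n^'n \<Rightarrow> 'a^'n^'n \<Rightarrow> int^2^2 \<Rightarrow> 'a^'n^'n \<Rightarrow> bool" where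
  "normal_words s u Y h \<longleftrightarrow> (\<exists>p k. alt_words s u p k \<and>
     (Y, h) \<in> {(p, k), (-p, -k), (Umat ** p, u ** k), (- (Umat ** p), - (u ** k)),
       (Umat ** (Umat ** p), u ** (u ** k)), (- (Umat ** (Umat ** p)), - (u ** (u ** k)))})"

text \<open>The key to uniqueness: a normal form that is 1 in \<open>SL(2, Z)\<close> is also 1 in
  terms of \<open>s\<close> and \<open>u\<close>. The sign patterns exclude every nontrivial prefix,
  and then the zeros off the diagonal force the value 1.\<close>

lemma normal_words_trivial:
  assumes "normal_words s u (mat 1) h"
  shows "h = mat 1"
proof -
  obtain p k where pk: "alt_words s u p k" and
     *: "(mat 1, h) \<in> {(p, k), (-p, -k), (Umat ** p, u ** k), (- (Umat ** p), - (u ** k)),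
       (Umat ** (Umat ** p), u ** (u ** k)), (- (Umat ** (Umat ** p)), - (u ** (u ** k)))}"
    using assms unfolding normal_words_def by blast
  show ?thesis
    using alt_words_entries[OF pk] * by (auto simp: mat2_simps)
qed

lemma SL2Z_relations: "Smat ** Smat = - mat 1" "Umat ** (Umat ** Umat) = - mat 1"
  by (simp_all add: mat2_simps)

locale modular_relations =
  fixes s u :: "'a::comm_ring_1^'n^'n"
  assumes ss: "s ** s = - mat 1" and uuu: "u ** (u ** u) = - mat 1"
begin

lemma ss_mult: "s ** (s ** h) = - h"
  by (simp add: matrix_mul_assoc ss matrix_minus_simps)

lemma uuu_mult: "u ** (u ** (u ** h)) = - h"
  using arg_cong[OF uuu, of "\<lambda>x. x ** h"]
  by (simp add: matrix_minus_simps flip: matrix_mul_assoc)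

lemma SS_mult: "Smat ** (Smat ** Y) = - Y"
  by (simp add: matrix_mul_assoc SL2Z_relations matrix_minus_simps)

lemma UUU_mult: "Umat ** (Umat ** (Umat ** Y)) = - Y"
  using arg_cong[OF SL2Z_relations(2), of "\<lambda>x. x ** Y"]
  by (simp add: matrix_minus_simps flip: matrix_mul_assoc)

lemmas rel_simps = ss_mult uuu_mult SS_mult UUU_mult matrix_minus_simps

lemma normal_words_U: "normal_words s u Y h \<Longrightarrow> normal_words s u (Umat ** Y) (u ** h)"
  unfolding normal_words_def by (elim exE conjE, rule exI, rule exI, erule conjI) (auto simp: rel_simps)

lemma normal_words_uminus: "normal_words s u Y h \<Longrightarrow> normal_words s u (- Y) (- h)"
  unfolding normal_words_def by (elim exE conjE, rule exI, rule exI, erule conjI) auto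

lemma normal_words_intros:
  assumes "alt_words s u p k"
  shows "normal_words s u p k" "normal_words s u (Umat ** p) (u ** k)"
    "normal_words s u (Umat ** (Umat ** p)) (u ** (u ** k))"
  using assms unfolding normal_words_def by blast+

text \<open>In front of the empty word \<open>S\<close> is a word, two letters \<open>S\<close>
  cancel to \<open>-1\<close>, and in front of a block \<open>S\<close> cancels and exposes
  \<open>U\<close> or \<open>U\<^sup>2\<close> as a prefix.\<close>

lemma alt_words_S:
  assumes "alt_words s u p k"
  shows "normal_words s u (Smat ** p) (s ** k)"
  using assms
proof cases
  case one
  then show ?thesis using normal_words_intros(1)[OF alt_words.S] by simp
next
  case S
  then show ?thesis
    using normal_words_uminus[OF normal_words_intros(1)[OF alt_words.one]] by (simp add: ss SL2Z_relations)
next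
  case (SU Y h)
  then show ?thesis using normal_words_intros(2)[OF SU(3)] by (simp add: rel_simps)
next
  case (SUU Y h)
  then show ?thesis using normal_words_intros(3)[OF SUU(3)] by (simp add: rel_simps)
qed

text \<open>A prefix that is trivial up to sign is the case of \<open>alt_words_S\<close>; with
  prefix \<open>U\<close> or \<open>U\<^sup>2\<close> the new \<open>S\<close> completes a
  block.\<close>

lemma normal_words_S:
  assumes "normal_words s u Y h"
  shows "normal_words s u (Smat ** Y) (s ** h)"
proof -
  obtain p k where pk: "alt_words s u p k" and
     *: "(Y, h) \<in> {(p, k), (-p, -k), (Umat ** p, u ** k), (- (Umat ** p), - (u ** k)),
       (Umat ** (Umat ** p), u ** (u ** k)), (- (Umat ** (Umat ** p)), - (u ** (u ** k)))}"
    using assms unfolding normal_words_def by blast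
  note 1 = alt_words_S[OF pk]
  note 2 = normal_words_intros(1)[OF alt_words.SU[OF pk]]
  note 3 = normal_words_intros(1)[OF alt_words.SUU[OF pk]]
  show ?thesis
    using * 1 2 3 normal_words_uminus[OF 1] normal_words_uminus[OF 2] normal_words_uminus[OF 3]
    by (auto simp: matrix_minus_simps)
qed

lemma words_imp_normal: "words s u Y h \<Longrightarrow> normal_words s u Y h"
  by (induction rule: words.induct)
     (auto intro: normal_words_S normal_words_U normal_words_intros(1)[OF alt_words.one])

lemma words_mult: "words s u X g \<Longrightarrow> words s u Y h \<Longrightarrow> words s u (X ** Y) (g ** h)"
  by (induction rule: words.induct) (auto simp: words.intros simp flip: matrix_mul_assoc)

lemma words_minus_one: "words s u (- mat 1) (- mat 1)"
  using words.S[OF words.S[OF words.one[of s u]]] by (simp add: ss SL2Z_relations)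

lemma words_uminus: "words s u Y h \<Longrightarrow> words s u (- Y) (- h)"
  using words_mult[OF words_minus_one] by (simp add: matrix_minus_simps)

text \<open>Since \<open>-1\<close> is a word, so are \<open>S\<^sup>-\<^sup>1 = - S\<close> and
  \<open>U\<^sup>-\<^sup>1 = - U\<^sup>2\<close>. The inverse is taken in both coordinates at once,
  so that uniqueness reduces to words for 1.\<close>

lemma words_inverse:
  assumes "words s u Y h"
  shows "\<exists>Y' h'. words s u Y' h' \<and> Y' ** Y = mat 1 \<and> Y ** Y' = mat 1 \<and> h' ** h = mat 1 \<and> h ** h' = mat 1"
  using assms
proof induction
  case one
  show ?case using words.one by (intro exI[of _ "mat 1"]) auto
next
  case (S Y h)
  then obtain Y' h' where *: "words s u Y' h'" "Y' ** Y = mat 1" "Y ** Y' = mat 1" "h' ** h = mat 1" "h ** h' = mat 1"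
    by blast
  have "words s u (- (Y' ** Smat)) (- (h' ** s))"
    using words_uminus[OF words_mult[OF *(1) words.S[OF words.one]]] by simp
  moreover have inv: "Y ** (Y' ** X) = X" "h ** (h' ** x) = x" for X x
    by (simp_all add: matrix_mul_assoc *)
  ultimately show ?case
    by (intro exI[of _ "- (Y' ** Smat)"] exI[of _ "- (h' ** s)"])
       (auto simp: inv rel_simps * ss SL2Z_relations simp flip: matrix_mul_assoc)
next
  case (U Y h)
  then obtain Y' h' where *: "words s u Y' h'" "Y' ** Y = mat 1" "Y ** Y' = mat 1" "h' ** h = mat 1" "h ** h' = mat 1"
    by blast
  have "words s u (- (Y' ** (Umat ** Umat))) (- (h' ** (u ** u)))"
    using words_uminus[OF words_mult[OF *(1) words.U[OF words.U[OF words.one]]]] by simp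
  moreover have inv: "Y ** (Y' ** X) = X" "h ** (h' ** x) = x" for X x
    by (simp_all add: matrix_mul_assoc *)
  ultimately show ?case
    by (intro exI[of _ "- (Y' ** (Umat ** Umat))"] exI[of _ "- (h' ** (u ** u))"])
       (auto simp: inv rel_simps * uuu SL2Z_relations simp flip: matrix_mul_assoc)
qed

lemma words_unique:
  assumes "words s u Y h1" "words s u Y h2"
  shows "h1 = h2"
proof -
  obtain Y' h' where *: "words s u Y' h'" "Y' ** Y = mat 1" "h' ** h1 = mat 1" "h1 ** h' = mat 1"
    using words_inverse[OF assms(1)] by blast
  have "words s u (mat 1) (h' ** h2)"
    using words_mult[OF *(1) assms(2)] by (simp add: *)
  then have "h' ** h2 = mat 1"
    using normal_words_trivial words_imp_normal by blast
  then have "h1 ** (h' ** h2) = h1" by simp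
  then show ?thesis by (simp add: matrix_mul_assoc *)
qed

section \<open>Generation of \<open>SL(2, Z)\<close> by the Euclidean algorithm\<close>

lemma words_S_cancel: "(\<exists>h. words s u (Smat ** Y) h) \<Longrightarrow> (\<exists>h. words s u Y h)"
  using words_uminus words.S by (metis SS_mult minus_minus)

lemma words_T_cancel: "(\<exists>h. words s u (Tmat ** Y) h) \<longleftrightarrow> (\<exists>h. words s u Y h)"
proof -
  \<comment> \<open>\<open>T = - S U\<close>, with inverse \<open>- U\<^sup>2 S\<close>.\<close>
  have eq: "Tmat ** Y = - (Smat ** (Umat ** Y))" "Y = - (Umat ** (Umat ** (Smat ** (Tmat ** Y))))"
    by (auto simp: mat2_simps Tmat_eq)
  show ?thesis
    using words_uminus words.S words.U eq by metis
qed

lemma words_shear: "(\<exists>h. words s u (mat2 1 (int n) 0 1 ** Y) h) \<longleftrightarrow> (\<exists>h. words s u Y h)"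
proof (induction n)
  case 0
  have "mat2 1 (int 0) 0 1 ** Y = Y" by (simp add: mat2_simps)
  then show ?case by simp
next
  case (Suc n)
  have "mat2 1 (int (Suc n)) 0 1 ** Y = Tmat ** (mat2 1 (int n) 0 1 ** Y)"
    by (simp add: mat2_simps Tmat_eq algebra_simps)
  then show ?case using Suc words_T_cancel by simp
qed

lemma words_shear_int: "(\<exists>h. words s u (mat2 1 k 0 1 ** Y) h) \<longleftrightarrow> (\<exists>h. words s u Y h)"
proof (cases "k \<ge> 0")
  case True
  then show ?thesis using words_shear[of "nat k" Y] by simp
next
  case False
  have "mat2 1 (-k) 0 1 ** (mat2 1 k 0 1 ** Y) = Y" by (simp add: mat2_simps algebra_simps)
  then show ?thesis using words_shear[of "nat (-k)" "mat2 1 k 0 1 ** Y"] False by simp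
qed

text \<open>Euclidean algorithm on the first column: a shear replaces \<open>Y$1$1\<close> by its
  remainder modulo \<open>Y$2$1\<close>, and \<open>S\<close> moves this remainder to the lower
  left. Once that entry is 0, \<open>Y\<close> is a shear up to sign.\<close>

lemma words_exists:
  assumes "det Y = 1"
  shows "\<exists>h. words s u Y h"
  using assms
proof (induction "nat \<bar>Y$2$1\<bar>" arbitrary: Y rule: less_induct)
  case less
  have d: "Y$1$1 * Y$2$2 - Y$1$2 * Y$2$1 = 1" using less.prems by (simp add: det_2)
  show ?case
  proof (cases "Y$2$1 = 0")
    case True
    with d have "Y$1$1 * Y$2$2 = 1" by simp
    then consider "Y$1$1 = 1" "Y$2$2 = 1" | "Y$1$1 = -1" "Y$2$2 = -1" using zmult_eq_1_iff by auto
    then show ?thesis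
    proof cases
      case 1
      then have "mat2 1 (- Y$1$2) 0 1 ** Y = mat 1" using True by (simp add: mat2_simps)
      then show ?thesis using words_shear_int[of "- Y$1$2" Y] words.one by auto
    next
      case 2
      then have "mat2 1 (Y$1$2) 0 1 ** Y = - mat 1" using True by (simp add: mat2_simps)
      then show ?thesis using words_shear_int[of "Y$1$2" Y] words_minus_one by auto
    qed
  next
    case False
    let ?q = "Y$1$1 div Y$2$1"
    let ?X = "Smat ** (mat2 1 (- ?q) 0 1 ** Y)"
    have "?X$2$1 = Y$1$1 mod Y$2$1"
      by (simp add: mat2_simps minus_div_mult_eq_mod)
    then have "\<bar>?X$2$1\<bar> < \<bar>Y$2$1\<bar>" using False by (simp add: abs_mod_less)
    moreover have "det ?X = 1"
      unfolding det_mul less.prems by (simp add: det_2)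
    ultimately have "\<exists>h. words s u ?X h" by (intro less.hyps) auto
    then show ?thesis using words_S_cancel words_shear_int by blast
  qed
qed

lemma SL2Z_representation:
  obtains M where "\<And>X Y. X \<in> SL2Z \<Longrightarrow> Y \<in> SL2Z \<Longrightarrow> M (X ** Y) = M X ** M Y"
    "M (mat 1) = mat 1" "M Smat = s" "M Umat = u"
proof
  define M where "M Y = (THE h. words s u Y h)" for Y
  have M: "M Y = h" if "words s u Y h" for Y h
    unfolding M_def using that words_unique by blast
  then have words_M: "words s u Y (M Y)" if "Y \<in> SL2Z" for Y
    using words_exists[of Y] that by (auto simp: SL2Z_def)
  show "M (X ** Y) = M X ** M Y" if "X \<in> SL2Z" "Y \<in> SL2Z" for X Y
    by (intro M words_mult words_M that)
  show "M (mat 1) = mat 1" by (intro M words.one)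
  show "M Smat = s" using M[OF words.S[OF words.one]] by simp
  show "M Umat = u" using M[OF words.U[OF words.one]] by simp
qed

end

text \<open>The locale is instantiated with the generators themselves: existence of words then says
  that \<open>S\<close> and \<open>U\<close> generate \<open>SL(2, Z)\<close> as a monoid.\<close>

lemma SL2Z_induct [consumes 1, case_names one S U]:
  assumes "Y \<in> SL2Z" "P (mat 1)" "\<And>Y. Y \<in> SL2Z \<Longrightarrow> P Y \<Longrightarrow> P (Smat ** Y)" "\<And>Y. Y \<in> SL2Z \<Longrightarrow> P Y \<Longrightarrow> P (Umat ** Y)"
  shows "P Y"
proof -
  interpret modular_relations Smat Umat
    by standard (simp_all add: SL2Z_relations)
  obtain h where "words Smat Umat Y h" using words_exists assms(1) by (auto simp: SL2Z_def)
  then have "P Y \<and> Y \<in> SL2Z"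
    by induction (auto simp: assms SL2Z_def det_mul, auto simp: det_2)
  then show ?thesis ..
qed

section \<open>Integer matrices of polynomial growth\<close>

lemma imat_act_eq_sum:
  assumes "finite K" "{j. v j \<noteq> 0} \<subseteq> K"
  shows "imat_act M v i = (\<Sum>j\<in>K. M i j * v j)"
  unfolding imat_act_def using assms by (intro sum.mono_neutral_left) auto

lemma imat_mult_eq_sum:
  assumes "finite K" "{k. B k j \<noteq> 0} \<subseteq> K"
  shows "imat_mult A B i j = (\<Sum>k\<in>K. A i k * B k j)"
  unfolding imat_mult_def using assms by (intro sum.mono_neutral_left) auto

lemma imat_mult_eq_act: "imat_mult A B i j = imat_act A (\<lambda>k. B k j) i"
  by (simp add: imat_mult_def imat_act_def)

lemma imat_act_nonzero: "imat_act M v i \<noteq> 0 \<Longrightarrow> \<exists>j. M i j \<noteq> 0 \<and> v j \<noteq> 0"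
  unfolding imat_act_def by (erule contrapos_np, rule sum.neutral) auto

lemma imat_mult_nonzero: "imat_mult A B i j \<noteq> 0 \<Longrightarrow> \<exists>k. A i k \<noteq> 0 \<and> B k j \<noteq> 0"
  by (auto simp: imat_mult_eq_act dest: imat_act_nonzero)

lemma colfinD:
  assumes "M \<in> colfin"
  shows "M 0 j = 0" "M i 0 = 0" "finite {i. M i j \<noteq> 0}"
  using assms by (auto simp: colfin_def)

lemma EspaceD:
  assumes "v \<in> Espace"
  shows "v 0 = 0" "finite {n. v n \<noteq> 0}"
  using assms by (auto simp: Espace_def)

lemma colfin_column_Espace: "M \<in> colfin \<Longrightarrow> (\<lambda>k. M k j) \<in> Espace"
  by (auto simp: colfin_def Espace_def)

lemma imat_act_in_Espace:
  assumes "M \<in> colfin" "v \<in> Espace"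
  shows "imat_act M v \<in> Espace"
proof -
  have "finite {n. v n \<noteq> 0}" using assms by (auto dest: EspaceD)
  moreover have "{i. imat_act M v i \<noteq> 0} \<subseteq> (\<Union>j\<in>{n. v n \<noteq> 0}. {i. M i j \<noteq> 0})"
    using imat_act_nonzero[of M v] by blast
  ultimately have "finite {i. imat_act M v i \<noteq> 0}"
    using colfinD(3)[OF assms(1)] by (meson finite_UN finite_subset)
  then show ?thesis
    using colfinD(1)[OF assms(1)] by (auto simp: Espace_def imat_act_def)
qed

lemma imat_act_assoc:
  assumes "B \<in> colfin" "v \<in> Espace"
  shows "imat_act (imat_mult A B) v = imat_act A (imat_act B v)"
proof
  fix i
  let ?J = "{j. v j \<noteq> 0}"
  define K where "K = (\<Union>j\<in>?J. {k. B k j \<noteq> 0})"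
  have fJ: "finite ?J" using assms by (auto dest: EspaceD)
  have fK: "finite K" unfolding K_def using fJ colfinD(3)[OF assms(1)] by blast
  have sub: "{k. imat_act B v k \<noteq> 0} \<subseteq> K"
    unfolding K_def using imat_act_nonzero[of B v] by blast
  have "imat_act (imat_mult A B) v i = (\<Sum>j\<in>?J. (\<Sum>k\<in>K. A i k * B k j) * v j)"
    unfolding imat_act_def
    by (intro sum.cong refl arg_cong2[of _ _ _ _ "(*)"] imat_mult_eq_sum fK) (auto simp: K_def)
  also have "\<dots> = (\<Sum>k\<in>K. A i k * (\<Sum>j\<in>?J. B k j * v j))"
    by (simp add: sum_distrib_left sum_distrib_right mult.assoc) (rule sum.swap)
  also have "\<dots> = imat_act A (imat_act B v) i"
    unfolding imat_act_eq_sum[OF fK sub] by (simp only: imat_act_def)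
  finally show "imat_act (imat_mult A B) v i = imat_act A (imat_act B v) i" .
qed

lemma imat_mult_assoc:
  assumes "B \<in> colfin" "C \<in> colfin"
  shows "imat_mult (imat_mult A B) C = imat_mult A (imat_mult B C)"
  by (intro ext)
     (simp add: imat_mult_eq_act imat_act_assoc[OF assms(1) colfin_column_Espace[OF assms(2)]])

lemma imat_one_act: "v \<in> Espace \<Longrightarrow> imat_act imat_one v = v"
proof
  fix i assume v: "v \<in> Espace"
  have "imat_act imat_one v i = (\<Sum>j\<in>{j. v j \<noteq> 0}. if i = j then v j else 0)"
    unfolding imat_act_def using EspaceD(1)[OF v] by (intro sum.cong) (auto simp: imat_one_def Suc_le_eq intro: gr0I)
  also have "\<dots> = v i" using EspaceD(2)[OF v] by (simp add: sum.delta)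
  finally show "imat_act imat_one v i = v i" .
qed

lemma imat_one_mult: "M \<in> colfin \<Longrightarrow> imat_mult imat_one M = M"
  by (intro ext) (simp add: imat_mult_eq_act imat_one_act colfin_column_Espace)

lemma imat_mult_colfin:
  assumes "A \<in> colfin" "B \<in> colfin"
  shows "imat_mult A B \<in> colfin"
proof -
  have "finite {i. imat_mult A B i j \<noteq> 0}" for j
    using EspaceD(2)[OF imat_act_in_Espace[OF assms(1) colfin_column_Espace[OF assms(2)], of j]]
    by (simp add: imat_mult_eq_act)
  moreover have "imat_mult A B 0 j = 0" "imat_mult A B i 0 = 0" for i j
    using colfinD(1)[OF assms(1)] colfinD(2)[OF assms(2)] by (simp_all add: imat_mult_def)
  ultimately show ?thesis
    unfolding colfin_def by blast
qed

text \<open>An integral variant of \<open>DR0\<close> with one natural exponent for all bounds. The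
  base \<open>j + 1\<close> is at least 2 for \<open>j \<ge> 1\<close>, so that constant factors can
  be absorbed into the exponent.\<close>

definition int_poly_mats :: "imat set" where
  "int_poly_mats = {M. \<exists>n::nat. \<forall>i j. M i j \<noteq> 0 \<longrightarrow>
     0 < i \<and> 0 < j \<and> i \<le> (j + 1) ^ n \<and> M i j \<in> \<int> \<and> norm (M i j) \<le> real ((j + 1) ^ n)}"

lemma int_poly_matsI:
  assumes "\<And>i j. M i j \<noteq> 0 \<Longrightarrow> 0 < i \<and> 0 < j \<and> i \<le> (j + 1) ^ n \<and> M i j \<in> \<int> \<and> norm (M i j) \<le> real ((j + 1) ^ n)"
  shows "M \<in> int_poly_mats"
  using assms unfolding int_poly_mats_def by blast

lemma int_poly_mats_Ints: "M \<in> int_poly_mats \<Longrightarrow> M i j \<in> \<int>"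
  unfolding int_poly_mats_def by (cases "M i j = 0") auto

lemma int_poly_mats_colfin: "M \<in> int_poly_mats \<Longrightarrow> M \<in> colfin"
proof -
  assume "M \<in> int_poly_mats"
  then obtain n where n: "\<And>i j. M i j \<noteq> 0 \<Longrightarrow> 0 < i \<and> 0 < j \<and> i \<le> (j + 1) ^ n"
    unfolding int_poly_mats_def by blast
  have "{i. M i j \<noteq> 0} \<subseteq> {..(j + 1) ^ n}" for j using n by auto
  then have "finite {i. M i j \<noteq> 0}" for j using finite_subset by blast
  then show ?thesis using n by (force simp: colfin_def)
qed

lemma int_poly_mats_DR0:
  assumes "M \<in> int_poly_mats"
  shows "M \<in> DR0"
proof -
  obtain n where n: "\<And>i j. M i j \<noteq> 0 \<Longrightarrow> 0 < i \<and> 0 < j \<and> i \<le> (j + 1) ^ n \<and> norm (M i j) \<le> real ((j + 1) ^ n)"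
    using assms unfolding int_poly_mats_def by blast
  \<comment> \<open>Since \<open>j + 1 \<le> 2 * j\<close>, the constant \<open>2 ^ n\<close> works;
    the exponent is \<open>Suc n\<close> because \<open>DR0\<close> asks for a positive one.\<close>
  have le: "real ((j + 1) ^ n) \<le> 2 ^ n * real j powr real (Suc n)" if "j \<ge> 1" for j
  proof -
    have "real ((j + 1) ^ n) \<le> (2 * real j) ^ n"
      unfolding of_nat_power using that by (intro power_mono) auto
    also have "\<dots> \<le> 2 ^ n * real j ^ Suc n"
      using that by (simp add: power_mult_distrib mult_le_cancel_left1 mult_le_cancel_right1)
    finally show ?thesis using that by (subst powr_realpow) auto
  qed
  have "(real i > 2 ^ n * real j powr real (Suc n) \<longrightarrow> M i j = 0) \<and> norm (M i j) \<le> 2 ^ n * real j powr real (Suc n)"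
    if "i \<ge> 1" "j \<ge> 1" for i j
  proof (cases "M i j = 0")
    case False
    then show ?thesis using n[OF False] le[OF that(2)]
      by (smt (verit, best) of_nat_mono)
  qed auto
  then show ?thesis
    unfolding DR0_def using int_poly_mats_colfin[OF assms]
    by (intro CollectI conjI exI[of _ "2 ^ n :: real"] exI[of _ "real (Suc n)"]) auto
qed

lemma imat_one_int_poly: "imat_one \<in> int_poly_mats"
  by (rule int_poly_matsI[of _ 1]) (auto simp: imat_one_def split: if_splits)

lemma imat_mult_int_poly:
  assumes "A \<in> int_poly_mats" "B \<in> int_poly_mats"
  shows "imat_mult A B \<in> int_poly_mats"
proof -
  obtain n where n: "\<And>i j. A i j \<noteq> 0 \<Longrightarrow> 0 < i \<and> 0 < j \<and> i \<le> (j + 1) ^ n \<and> A i j \<in> \<int> \<and> norm (A i j) \<le> real ((j + 1) ^ n)"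
    using assms(1) unfolding int_poly_mats_def by blast
  obtain m where m: "\<And>i j. B i j \<noteq> 0 \<Longrightarrow> 0 < i \<and> 0 < j \<and> i \<le> (j + 1) ^ m \<and> B i j \<in> \<int> \<and> norm (B i j) \<le> real ((j + 1) ^ m)"
    using assms(2) unfolding int_poly_mats_def by blast
  \<comment> \<open>Column \<open>j\<close> of \<open>B\<close> has at most
    \<open>(j + 1) ^ m\<close> nonzero entries, each of norm at most \<open>(j + 1) ^ m\<close>.
    Their rows \<open>k\<close> satisfy \<open>k + 1 \<le> (j + 1) ^ Suc m\<close>, so the entries
    of \<open>A\<close> are at most \<open>(j + 1) ^ (Suc m * n)\<close>.\<close>
  define N where "N = m + (Suc m * n + m)"
  have le: "(k + 1) ^ n \<le> (j + 1) ^ (Suc m * n)" if "B k j \<noteq> 0" for k j :: nat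
  proof -
    have "k + 1 \<le> (j + 1) ^ m + (j + 1) ^ m * j"
      using m[OF that] by (intro add_mono) auto
    also have "\<dots> = (j + 1) ^ Suc m" by simp
    finally show ?thesis by (metis power_mono power_mult zero_le)
  qed
  show ?thesis
  proof (rule int_poly_matsI[of _ N])
    fix i j assume nz: "imat_mult A B i j \<noteq> 0"
    let ?K = "{k. B k j \<noteq> 0}"
    obtain k where k: "A i k \<noteq> 0" "B k j \<noteq> 0"
      using imat_mult_nonzero[OF nz] by blast
    have "i \<le> (j + 1) ^ (Suc m * n)" using n[OF k(1)] le[OF k(2)] by simp
    also have "\<dots> \<le> (j + 1) ^ N" unfolding N_def by (intro power_increasing) auto
    finally have 1: "i \<le> (j + 1) ^ N" .
    have "?K \<subseteq> {1..(j + 1) ^ m}" using m by (auto simp: Suc_le_eq)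
    then have card: "card ?K \<le> (j + 1) ^ m" using card_mono[of "{1..(j + 1) ^ m}" ?K] by simp
    have le_term: "norm (A i k * B k j) \<le> real ((j + 1) ^ (Suc m * n + m))" if "k \<in> ?K" for k
    proof (cases "A i k = 0")
      case False
      have "norm (A i k) \<le> real ((j + 1) ^ (Suc m * n))"
        using n[OF False] le[of k j] that by (metis (mono_tags, lifting) mem_Collect_eq of_nat_mono order_trans)
      moreover have "norm (B k j) \<le> real ((j + 1) ^ m)" using m that by auto
      ultimately show ?thesis unfolding norm_mult power_add of_nat_mult by (intro mult_mono) auto
    qed auto
    have "norm (imat_mult A B i j) \<le> real (card ?K) * real ((j + 1) ^ (Suc m * n + m))"
      unfolding imat_mult_def by (rule sum_norm_bound[OF le_term])
    also have "\<dots> \<le> real ((j + 1) ^ m) * real ((j + 1) ^ (Suc m * n + m))"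
      using card by (intro mult_right_mono) (auto simp only: of_nat_le_iff of_nat_0_le_iff)
    also have "\<dots> = real ((j + 1) ^ N)" by (simp add: N_def power_add)
    finally have 2: "norm (imat_mult A B i j) \<le> real ((j + 1) ^ N)" .
    have "imat_mult A B i j \<in> \<int>"
      unfolding imat_mult_def
      by (intro Ints_sum Ints_mult int_poly_mats_Ints assms)
    then show "0 < i \<and> 0 < j \<and> i \<le> (j + 1) ^ N \<and> imat_mult A B i j \<in> \<int> \<and> norm (imat_mult A B i j) \<le> real ((j + 1) ^ N)"
      using 1 2 n[OF k(1)] m[OF k(2)] by blast
  qed
qed

section \<open>Matrices over power series\<close>

definition odd_part :: "nat \<Rightarrow> nat" where
  "odd_part n = n div 2 ^ multiplicity 2 n"

definition level :: "nat \<Rightarrow> nat" where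
  "level n = multiplicity 2 n div 2"

definition slot :: "nat \<Rightarrow> 2" where
  "slot n = (if even (multiplicity 2 n) then 1 else 2)"

definition position :: "nat \<Rightarrow> nat \<Rightarrow> 2 \<Rightarrow> nat" where
  "position m c e = (if e = 1 then 1 else 2) * (m * 4 ^ c)"

lemma multiplicity_2_odd_times: "odd m \<Longrightarrow> multiplicity 2 (m * 2 ^ l) = (l::nat)" for m :: nat
  by (intro multiplicity_eqI) (auto simp: odd_pos)

lemma two_neq_one: "(2::2) \<noteq> 1" "(1::2) \<noteq> 2"
  by auto

lemma position_eq_power: "position m c e = m * 2 ^ (2 * c + (if e = 1 then 0 else 1))"
  by (simp add: position_def power_mult)

lemma
  assumes "odd m"
  shows odd_part_position: "odd_part (position m c e) = m"
    and level_position: "level (position m c e) = c"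
    and slot_position: "slot (position m c e) = e"
proof -
  note * = multiplicity_2_odd_times[OF assms, of "2 * c + (if e = 1 then 0 else 1)"]
  show "odd_part (position m c e) = m" unfolding odd_part_def position_eq_power * by simp
  show "level (position m c e) = c" unfolding level_def position_eq_power * by simp
  have "e = 2" if "e \<noteq> 1" using exhaust_2[of e] that by auto
  then show "slot (position m c e) = e" unfolding slot_def position_eq_power * by auto
qed

lemma
  assumes "0 < n"
  shows odd_odd_part: "odd (odd_part n)"
    and odd_part_times: "odd_part n * 2 ^ multiplicity 2 n = n"
  using multiplicity_decompose[of n 2] multiplicity_dvd[of 2 n] assms unfolding odd_part_def by auto

lemma position_collapse: "0 < n \<Longrightarrow> position (odd_part n) (level n) (slot n) = n"
proof -
  assume "0 < n"
  have "2 * level n + (if slot n = 1 then 0 else 1) = multiplicity 2 n"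
    by (auto simp: level_def slot_def)
  then show "position (odd_part n) (level n) (slot n) = n"
    unfolding position_eq_power using odd_part_times[OF \<open>0 < n\<close>] by simp
qed

text \<open>A matrix over power series acts on the basis vectors with a fixed odd part \<open>m\<close>, those at
  positions \<open>m 4\<^sup>c\<close> and \<open>2 m 4\<^sup>c\<close> being thought of as \<open>y\<^sup>c\<close> times the two unit vectors.\<close>
definition lift :: "(int fps)^2^2 \<Rightarrow> imat" where
  "lift M i j = (if 0 < i \<and> 0 < j \<and> odd_part i = odd_part j \<and> level i \<le> level j
     then of_int (fps_nth (vec_nth (vec_nth M (slot i)) (slot j)) (level j - level i)) else 0)"

lemma lift_nonzeroD:
  assumes "lift M i j \<noteq> 0"
  shows "0 < i" "0 < j" "odd_part i = odd_part j" "level i \<le> level j"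
  using assms by (auto simp: lift_def split: if_splits)

text \<open>Column \<open>j\<close> is supported on positions with the odd part of \<open>j\<close>
  and level at most \<open>level j\<close>, so intermediate indices become pairs of a level and a
  slot.\<close>

lemma sum_lift_column:
  assumes "0 < j"
  shows "imat_mult A (lift M) i j = (\<Sum>c\<le>level j. \<Sum>e\<in>UNIV. A i (position (odd_part j) c e) * lift M (position (odd_part j) c e) j)"
proof -
  let ?p = "\<lambda>(c, e). position (odd_part j) c e"
  have odd: "odd (odd_part j)" using odd_odd_part[OF assms] .
  have inj: "inj_on ?p ({..level j} \<times> UNIV)"
    by (auto simp: inj_on_def) (metis level_position odd, metis slot_position odd)
  have "k \<in> ?p ` ({..level j} \<times> UNIV)" if "lift M k j \<noteq> 0" for k
  proof
    show "k = ?p (level k, slot k)" using position_collapse[of k] lift_nonzeroD[OF that] by simp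
    show "(level k, slot k) \<in> {..level j} \<times> UNIV" using lift_nonzeroD[OF that] by simp
  qed
  then have "imat_mult A (lift M) i j = (\<Sum>k\<in>?p ` ({..level j} \<times> UNIV). A i k * lift M k j)"
    by (intro imat_mult_eq_sum) auto
  also have "\<dots> = (\<Sum>(c, e)\<in>{..level j} \<times> UNIV. A i (position (odd_part j) c e) * lift M (position (odd_part j) c e) j)"
    by (subst sum.reindex[OF inj]) (simp add: case_prod_unfold)
  finally show ?thesis by (simp add: sum.cartesian_product)
qed

lemma position_pos: "odd m \<Longrightarrow> 0 < position m c e"
  by (auto simp: position_def odd_pos)

lemma lift_mult: "imat_mult (lift M) (lift N) = lift (M ** N)"
proof (intro ext)
  fix i j
  consider "j = 0" | "0 < j" "\<not> (0 < i \<and> odd_part i = odd_part j \<and> level i \<le> level j)"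
    | "0 < j" "0 < i" "odd_part i = odd_part j" "level i \<le> level j" by blast
  then show "imat_mult (lift M) (lift N) i j = lift (M ** N) i j"
  proof cases
    case 1
    then show ?thesis by (simp add: imat_mult_def lift_def)
  next
    case 2
    have "\<not> (lift M i k \<noteq> 0 \<and> lift N k j \<noteq> 0)" for k
      using 2 by (metis lift_nonzeroD order_trans)
    then have "imat_mult (lift M) (lift N) i j = 0" using imat_mult_nonzero by blast
    then show ?thesis using 2 by (auto simp: lift_def)
  next
    case 3
    let ?m = "odd_part j"
    have odd: "odd ?m" using odd_odd_part 3 by blast
    define d where "d = level j - level i"
    let ?M = "\<lambda>e n. fps_nth (vec_nth (vec_nth M (slot i)) e) n"
    let ?N = "\<lambda>e n. fps_nth (vec_nth (vec_nth N e) (slot j)) n"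
    have "imat_mult (lift M) (lift N) i j = (\<Sum>c\<le>level j. \<Sum>e\<in>UNIV.
        if level i \<le> c then of_int (?M e (c - level i) * ?N e (level j - c)) else 0)"
      unfolding sum_lift_column[OF 3(1)] using 3
      by (intro sum.cong refl)
         (auto simp: lift_def position_pos odd odd_part_position level_position slot_position)
    also have "\<dots> = (\<Sum>c\<in>{level i..level j}. \<Sum>e\<in>UNIV. of_int (?M e (c - level i) * ?N e (level j - c)))"
      by (intro sum.mono_neutral_cong_right) auto
    \<comment> \<open>With \<open>t = c - level i\<close> the sum over intermediate levels is a
      Cauchy product of power series.\<close>
    also have "\<dots> = (\<Sum>t\<in>{0..d}. \<Sum>e\<in>UNIV. of_int (?M e t * ?N e (d - t)))"
      by (intro sum.reindex_bij_witness[of _ "\<lambda>t. t + level i" "\<lambda>c. c - level i"]) (use 3 in \<open>auto simp: d_def\<close>)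
    also have "\<dots> = of_int (\<Sum>e\<in>UNIV. \<Sum>t\<in>{0..d}. ?M e t * ?N e (d - t))"
      by (subst sum.swap) simp
    also have "\<dots> = lift (M ** N) i j"
      using 3 by (simp add: lift_def d_def matrix_matrix_mult_def fps_sum_nth fps_mult_nth)
    finally show ?thesis .
  qed
qed

lemma lift_one: "lift (mat 1) = imat_one"
proof (intro ext)
  fix i j
  have "i = j" if "0 < i" "0 < j" "odd_part i = odd_part j" "level i = level j" "slot i = slot j"
    using position_collapse that by metis
  then show "lift (mat 1) i j = imat_one i j"
    by (auto simp: lift_def imat_one_def mat_def)
qed

lemma
  assumes "0 < n"
  shows four_power_level_le: "odd_part n * 4 ^ level n \<le> n"
    and le_four_power_level: "n \<le> 2 * (odd_part n * 4 ^ level n)"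
proof -
  define x where "x = odd_part n * 4 ^ level n"
  have "(if slot n = 1 then 1 else 2) * x = n"
    using position_collapse[OF assms] unfolding position_def x_def .
  then show "odd_part n * 4 ^ level n \<le> n" "n \<le> 2 * (odd_part n * 4 ^ level n)"
    unfolding x_def[symmetric] by (auto split: if_splits)
qed

text \<open>Exponential growth in the power of \<open>y\<close> becomes polynomial growth in the
  index, because \<open>4 ^ level j \<le> j\<close>. The rate 4 is that of the Catalan
  numbers.\<close>

lemma lift_int_poly:
  assumes "\<And>a b k. \<bar>fps_nth (vec_nth (vec_nth M a) b) k\<bar> \<le> 2 * 4 ^ k"
  shows "lift M \<in> int_poly_mats"
proof (rule int_poly_matsI[of _ 2])
  fix i j assume nz: "lift M i j \<noteq> 0"
  note * = lift_nonzeroD[OF nz]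
  have pos: "odd_part j > 0" using odd_odd_part[OF *(2)] by (simp add: odd_pos)
  have "i \<le> 2 * (odd_part j * 4 ^ level i)" using le_four_power_level[of i] * by simp
  also have "\<dots> \<le> 2 * (odd_part j * 4 ^ level j)" using *(4) by (intro mult_left_mono power_increasing) auto
  also have "\<dots> \<le> 2 * j" using four_power_level_le[of j] * by simp
  also have le: "\<dots> \<le> (j + 1) ^ 2" by (simp add: power2_eq_square)
  finally have 1: "i \<le> (j + 1) ^ 2" .
  have "norm (lift M i j) = real_of_int \<bar>fps_nth (vec_nth (vec_nth M (slot i)) (slot j)) (level j - level i)\<bar>"
    using * by (simp add: lift_def)
  also have "\<dots> \<le> real_of_int (2 * 4 ^ (level j - level i))"
    using assms by (simp only: of_int_le_iff)
  also have "\<dots> \<le> 2 * 4 ^ level j" by (simp add: power_increasing)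
  also have "\<dots> = real (2 * (1 * 4 ^ level j))" by simp
  also have "\<dots> \<le> real (2 * (odd_part j * 4 ^ level j))"
    using pos by (intro of_nat_mono mult_left_mono mult_right_mono) auto
  also have "\<dots> \<le> real (2 * j)" using four_power_level_le[of j] * by (intro of_nat_mono) simp
  also have "\<dots> \<le> real ((j + 1) ^ 2)" using le by (rule of_nat_mono)
  finally show "0 < i \<and> 0 < j \<and> i \<le> (j + 1)\<^sup>2 \<and> lift M i j \<in> \<int> \<and> norm (lift M i j) \<le> real ((j + 1)\<^sup>2)"
    using 1 * by (simp add: lift_def)
qed

section \<open>Signed Catalan numbers and the modular relations over
  \<open>\<int>[[y]]\<close>\<close>

fun signed_catalan :: "nat \<Rightarrow> int" where
  "signed_catalan 0 = 1"
| "signed_catalan (Suc n) = - (\<Sum>i=0..n. signed_catalan i * signed_catalan (n - i))"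

declare signed_catalan.simps(2) [simp del]

lemmas signed_catalan_Suc = signed_catalan.simps(2)

text \<open>The partial sums of \<open>\<bar>c\<^sub>n\<bar> / 4\<^sup>n\<close> satisfy \<open>s\<^sub>n\<^sub>+\<^sub>1 \<le> 1 + s\<^sub>n\<^sup>2 / 4\<close>, so they stay below 2.\<close>
lemma signed_catalan_bound: "\<bar>signed_catalan n\<bar> \<le> 2 * 4 ^ n"
proof -
  define a where "a k = real_of_int \<bar>signed_catalan k\<bar> / 4 ^ k" for k
  have a_nonneg: "a k \<ge> 0" for k by (simp add: a_def)
  have a_Suc: "a (Suc k) \<le> (\<Sum>i\<le>k. a i * a (k - i)) / 4" for k
  proof -
    have "real_of_int \<bar>signed_catalan (Suc k)\<bar> \<le> real_of_int (\<Sum>i=0..k. \<bar>signed_catalan i * signed_catalan (k - i)\<bar>)"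
      unfolding signed_catalan_Suc abs_minus_cancel of_int_le_iff by (rule sum_abs)
    also have "\<dots> = (\<Sum>i\<le>k. a i * a (k - i) * 4 ^ k)"
      unfolding of_int_sum atLeast0AtMost
      by (intro sum.cong) (auto simp: a_def abs_mult simp flip: power_add)
    finally have "real_of_int \<bar>signed_catalan (Suc k)\<bar> \<le> (\<Sum>i\<le>k. a i * a (k - i)) * 4 ^ k"
      by (simp only: sum_distrib_right)
    then show ?thesis unfolding a_def[of "Suc k"] by (simp add: divide_simps)
  qed
  have sum_a: "(\<Sum>k\<le>n. a k) \<le> 2" for n
  proof (induction n)
    case 0
    show ?case by (simp add: a_def)
  next
    case (Suc n)
    have "(\<Sum>k\<le>Suc n. a k) = a 0 + (\<Sum>k\<le>n. a (Suc k))" by (rule sum.atMost_Suc_shift)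
    also have "\<dots> \<le> 1 + (\<Sum>k\<le>n. (\<Sum>i\<le>k. a i * a (k - i)) / 4)"
      using a_Suc by (intro add_mono sum_mono) (auto simp: a_def)
    also have "(\<Sum>k\<le>n. (\<Sum>i\<le>k. a i * a (k - i)) / 4) = (\<Sum>(i, j)\<in>{(i, j). i + j \<le> n}. a i * a j) / 4"
      by (simp add: sum.triangle_reindex_eq flip: sum_divide_distrib)
    also have "(\<Sum>(i, j)\<in>{(i, j). i + j \<le> n}. a i * a j) \<le> (\<Sum>(i, j)\<in>{..n} \<times> {..n}. a i * a j)"
      by (intro sum_mono2) (auto simp: a_nonneg)
    also have "\<dots> = (\<Sum>k\<le>n. a k) ^ 2"
      by (simp add: power2_eq_square sum_product sum.cartesian_product)
    also have "\<dots> \<le> 2 ^ 2" by (intro power_mono Suc.IH sum_nonneg a_nonneg)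
    finally show ?case by simp
  qed
  have "a n \<le> (\<Sum>k\<le>n. a k)" by (intro member_le_sum) (auto simp: a_nonneg)
  then have "a n \<le> 2" using sum_a[of n] by linarith
  then have "real_of_int \<bar>signed_catalan n\<bar> \<le> real_of_int (2 * 4 ^ n)" by (simp add: a_def divide_simps)
  then show ?thesis by (simp only: of_int_le_iff)
qed

definition catalan_fps :: "int fps" where
  "catalan_fps = Abs_fps signed_catalan"

lemma catalan_fps_eq: "catalan_fps * (1 + fps_X * catalan_fps) = 1"
proof -
  have "fps_nth catalan_fps n = fps_nth (1 - fps_X * (catalan_fps * catalan_fps)) n" for n
    by (cases n) (auto simp: catalan_fps_def fps_mult_nth[of "Abs_fps _" "Abs_fps _"] signed_catalan_Suc)
  then have "catalan_fps = 1 - fps_X * (catalan_fps * catalan_fps)" by (rule fps_ext)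
  then show ?thesis by (simp add: algebra_simps)
qed

definition S_fps :: "(int fps)^2^2" where "S_fps = mat2 0 (- catalan_fps) (1 + fps_X * catalan_fps) 0"
definition T_fps :: "(int fps)^2^2" where "T_fps = mat2 1 1 fps_X (1 + fps_X)"
definition T_inv_fps :: "(int fps)^2^2" where "T_inv_fps = mat2 (1 + fps_X) (- 1) (- fps_X) 1"

lemma T_fps_inverse: "T_inv_fps ** T_fps = mat 1"
  by (simp add: mat2_simps T_fps_def T_inv_fps_def algebra_simps)

lemma S_fps_square: "S_fps ** S_fps = - mat 1"
  using catalan_fps_eq by (simp add: mat2_simps S_fps_def algebra_simps)

text \<open>By Cayley-Hamilton \<open>M\<^sup>2 = M - 1\<close>, hence
  \<open>M\<^sup>3 = M\<^sup>2 - M = -1\<close>.\<close>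

lemma cayley_hamilton_cube:
  fixes M :: "'a::comm_ring_1^2^2"
  assumes "det M = 1" "M$1$1 + M$2$2 = 1"
  shows "M ** (M ** M) = - mat 1"
proof -
  have d: "M$2$2 = 1 - M$1$1" using assms(2) by (simp add: algebra_simps)
  have bc: "M$1$2 * M$2$1 = M$1$1 * (1 - M$1$1) - 1" using assms(1) by (simp add: det_2 d algebra_simps)
  have "M ** M = M - mat 1"
    using bc by (simp add: mat2_simps d algebra_simps)
  then show ?thesis by (simp add: matrix_add_ldistrib matrix_mult_minus_right flip: add_uminus_conv_diff)
qed

lemma ST_fps_cube: "(S_fps ** T_fps) ** ((S_fps ** T_fps) ** (S_fps ** T_fps)) = - mat 1"
proof (rule cayley_hamilton_cube)
  show "det (S_fps ** T_fps) = 1"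
    using catalan_fps_eq by (simp add: det_mul) (simp add: det_2 S_fps_def T_fps_def algebra_simps)
  show "vec_nth (vec_nth (S_fps ** T_fps) 1) 1 + vec_nth (vec_nth (S_fps ** T_fps) 2) 2 = 1"
    by (simp add: mat2_simps S_fps_def T_fps_def algebra_simps)
qed

section \<open>Passing to the model\<close>

lemma imat_mult_diff_left:
  "imat_mult (\<lambda>i j. A i j - B i j) C = (\<lambda>i j. imat_mult A C i j - imat_mult B C i j)"
  by (intro ext) (simp add: imat_mult_def left_diff_distrib sum_subtractf)

text \<open>One-sided inverses of column-finite matrices need not be two-sided; triangularity helps.
  \<open>X = B A\<close> is idempotent and triangular with ones on the diagonal, and in column
  \<open>j\<close> of \<open>(X - 1) X = 0\<close> induction removes all terms but
  \<open>(X i j - imat_one i j) * X j j\<close>.\<close>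

lemma upper_triangular_inverse:
  assumes A: "A \<in> colfin" "\<And>i j. A i j \<noteq> 0 \<Longrightarrow> i \<le> j"
    and B: "B \<in> colfin" "\<And>i j. B i j \<noteq> 0 \<Longrightarrow> i \<le> j"
    and AB: "imat_mult A B = imat_one"
  shows "imat_mult B A = imat_one"
proof -
  define X where "X = imat_mult B A"
  have Xc: "X \<in> colfin" unfolding X_def by (intro imat_mult_colfin A B)
  have upper: "i \<le> j" if "X i j \<noteq> 0" for i j
    using imat_mult_nonzero[of B A i j] that A(2) B(2) order_trans unfolding X_def by blast
  have mult_diag: "imat_mult P Q i i = P i i * Q i i"
    if "\<And>i j. P i j \<noteq> 0 \<Longrightarrow> i \<le> j" "\<And>i j. Q i j \<noteq> 0 \<Longrightarrow> i \<le> j" for P Q i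
  proof -
    have "imat_mult P Q i i = (\<Sum>k\<in>{..i}. P i k * Q k i)"
      using that(2) by (intro imat_mult_eq_sum) auto
    also have "\<dots> = (\<Sum>k\<in>{i}. P i k * Q k i)"
      using that(1) by (intro sum.mono_neutral_right) force+
    finally show ?thesis by simp
  qed
  have diag: "X i i = 1" if "0 < i" for i
    using mult_diag[of A B i, OF A(2) B(2)] mult_diag[of B A i, OF B(2) A(2)] that
    by (simp add: X_def AB imat_one_def mult.commute)
  have "imat_mult X X = imat_mult B (imat_mult (imat_mult A B) A)"
    by (simp add: X_def imat_mult_assoc imat_mult_colfin A B)
  also have "\<dots> = X" by (simp add: AB imat_one_mult A X_def)
  finally have XX: "imat_mult X X = X" .
  have "X i j - imat_one i j = 0" for i j
  proof (induction j rule: less_induct)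
    case (less j)
    show ?case
    proof (cases "j = 0")
      case True
      then show ?thesis using colfinD(2)[OF Xc] by (auto simp: imat_one_def)
    next
      case False
      have "0 = imat_mult (\<lambda>i j. X i j - imat_one i j) X i j"
        by (simp add: imat_mult_diff_left XX imat_one_mult Xc)
      also have "\<dots> = (\<Sum>k\<in>{..j}. (X i k - imat_one i k) * X k j)"
        using upper by (intro imat_mult_eq_sum) auto
      also have "\<dots> = (\<Sum>k\<in>{j}. (X i k - imat_one i k) * X k j)"
        using less.IH by (intro sum.mono_neutral_right) auto
      finally show ?thesis using diag[of j] False by simp
    qed
  qed
  then show ?thesis by (intro ext) (simp add: X_def)
qed

section \<open>The matrix \<open>T\<close> in terms of doubling indices\<close>

lemma multiplicity_double: "0 < n \<Longrightarrow> multiplicity 2 (2 * n) = Suc (multiplicity 2 (n::nat))"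
  by (rule multiplicity_times_same) auto

lemma odd_part_double: "0 < n \<Longrightarrow> odd_part (2 * n) = odd_part n"
  by (simp add: odd_part_def multiplicity_double)

lemma slot_cases: obtains "slot n = 1" | "slot n = 2"
  using exhaust_2 by blast

lemma slot_double: "0 < n \<Longrightarrow> slot (2 * n) = (if slot n = 1 then 2 else 1)"
  by (simp add: slot_def multiplicity_double)

lemma level_double: "0 < n \<Longrightarrow> level (2 * n) = (if slot n = 1 then level n else Suc (level n))"
  by (auto simp: slot_def level_def multiplicity_double)

lemma nat_eq_iff_position:
  assumes "0 < i" "0 < j"
  shows "i = j \<longleftrightarrow> odd_part i = odd_part j \<and> level i = level j \<and> slot i = slot j"
  using position_collapse assms by metis

lemma
  assumes "0 < i" "0 < k"
  shows eq_double_iff: "k = 2 * i \<longleftrightarrow> odd_part k = odd_part i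
      \<and> level k = (if slot i = 1 then level i else Suc (level i)) \<and> slot k = (if slot i = 1 then 2 else 1)"
    and eq_quadruple_iff: "k = 4 * i \<longleftrightarrow> odd_part k = odd_part i \<and> level k = Suc (level i) \<and> slot k = slot i"
proof -
  show "k = 2 * i \<longleftrightarrow> odd_part k = odd_part i
      \<and> level k = (if slot i = 1 then level i else Suc (level i)) \<and> slot k = (if slot i = 1 then 2 else 1)"
    using nat_eq_iff_position[of k "2 * i"] assms
    by (simp add: odd_part_double slot_double level_double)
  have "slot i = 1 \<or> slot i = 2" using exhaust_2 by blast
  then show "k = 4 * i \<longleftrightarrow> odd_part k = odd_part i \<and> level k = Suc (level i) \<and> slot k = slot i"
    using nat_eq_iff_position[of k "2 * (2 * i)"] assms odd_part_double[of "2 * i"]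
      slot_double[of "2 * i"] level_double[of "2 * i"] odd_part_double[of i]
      slot_double[of i] level_double[of i]
    by (elim disjE) simp_all
qed

text \<open>Doubling leads from slot 1 to slot 2 of the same level, and from slot 2 to slot 1 of the
  next. Hence the block rows \<open>(1, 1)\<close> and \<open>(y, 1 + y)\<close> have their ones at
  \<open>i, 2 * i\<close> and at \<open>i, 2 * i, 4 * i\<close>.\<close>

lemma lift_T_fps:
  assumes "0 < i" "0 < k"
  shows "lift T_fps i k = of_bool (k = i) + of_bool (k = 2 * i) + of_bool (slot i = 2 \<and> k = 4 * i)"
  unfolding nat_eq_iff_position[OF assms(2,1)] eq_double_iff[OF assms] eq_quadruple_iff[OF assms]
  using assms by (cases i rule: slot_cases; cases k rule: slot_cases) (auto simp: lift_def T_fps_def)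

lemma lift_T_inv_fps:
  assumes "0 < j" "0 < k"
  shows "lift T_inv_fps k j = of_bool (k = j) - of_bool (j = 2 * k) + of_bool (slot j = 1 \<and> j = 4 * k)"
  unfolding nat_eq_iff_position[OF assms(2,1)] eq_double_iff[OF assms(2,1)] eq_quadruple_iff[OF assms(2,1)]
  using assms by (cases j rule: slot_cases; cases k rule: slot_cases) (auto simp: lift_def T_inv_fps_def)

lemma lift_T_mult:
  assumes "M \<in> colfin" "0 < i"
  shows "imat_mult (lift T_fps) M i j = M i j + M (2 * i) j + (if slot i = 2 then M (4 * i) j else 0)"
proof -
  let ?K = "{k. M k j \<noteq> 0} \<union> {i, 2 * i, 4 * i}"
  have "k \<in> {i, 2 * i, 4 * i}" if "lift T_fps i k \<noteq> 0" for k
    using that lift_T_fps[OF assms(2), of k] lift_nonzeroD(2)[OF that] by (auto simp: of_bool_def split: if_splits)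
  note * = this
  have "imat_mult (lift T_fps) M i j = (\<Sum>k\<in>?K. lift T_fps i k * M k j)"
    using colfinD(3)[OF assms(1)] by (intro imat_mult_eq_sum) auto
  also have "\<dots> = (\<Sum>k\<in>{i, 2 * i, 4 * i}. lift T_fps i k * M k j)"
    using colfinD(3)[OF assms(1), of j] * by (intro sum.mono_neutral_right) auto
  also have "\<dots> = M i j + M (2 * i) j + (if slot i = 2 then M (4 * i) j else 0)"
    using assms(2) by (simp add: lift_T_fps)
  finally show ?thesis .
qed

lemma mult_lift_T_inv:
  assumes "\<And>i. M i 0 = 0" "0 < j"
  shows "imat_mult M (lift T_inv_fps) i j = M i j - (if even j then M i (j div 2) else 0)
     + (if slot j = 1 \<and> 4 dvd j then M i (j div 4) else 0)"
proof -
  let ?g = "\<lambda>k. M i k * (of_bool (k = j) - of_bool (even j \<and> k = j div 2) + of_bool (slot j = 1 \<and> 4 dvd j \<and> k = j div 4))"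
  have e: "(j = 2 * k) = (even j \<and> k = j div 2)" "(j = 4 * k) = (4 dvd j \<and> k = j div 4)" for k
    by auto
  have "k \<le> j" if "lift T_inv_fps k j \<noteq> 0" for k
    using that lift_T_inv_fps[OF assms(2), of k] lift_nonzeroD(1)[OF that] by (auto simp: of_bool_def split: if_splits)
  then have "imat_mult M (lift T_inv_fps) i j = (\<Sum>k\<in>{..j}. M i k * lift T_inv_fps k j)"
    by (intro imat_mult_eq_sum) auto
  also have "\<dots> = (\<Sum>k\<in>{..j}. ?g k)"
  proof (intro sum.cong refl)
    fix k
    show "M i k * lift T_inv_fps k j = ?g k"
    proof (cases "k = 0")
      case False
      then show ?thesis by (simp only: lift_T_inv_fps[OF assms(2)] e)
    qed (simp add: assms)
  qed
  also have "\<dots> = (\<Sum>k\<in>{..j}. if k = j then M i k else 0) - (\<Sum>k\<in>{..j}. if even j \<and> k = j div 2 then M i k else 0)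
     + (\<Sum>k\<in>{..j}. if slot j = 1 \<and> 4 dvd j \<and> k = j div 4 then M i k else 0)"
    unfolding sum_subtractf[symmetric] sum.distrib[symmetric]
    by (intro sum.cong refl) (simp add: of_bool_def)
  also have "\<dots> = M i j - (if even j then M i (j div 2) else 0)
     + (if slot j = 1 \<and> 4 dvd j then M i (j div 4) else 0)"
    by (cases "even j"; cases "slot j = 1 \<and> 4 dvd j") (auto simp: sum.delta)
  finally show ?thesis .
qed

section \<open>Multiplication by \<open>\<zeta>\<close> and bounds on divisor sums\<close>

lemma divisor_matrix_colfin: "divisor_matrix \<in> colfin"
proof -
  have "{i. divisor_matrix i j \<noteq> 0} \<subseteq> {..j}" for j
    by (auto simp: divisor_matrix_def dest: dvd_imp_le)
  then have "finite {i. divisor_matrix i j \<noteq> 0}" for j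
    using finite_subset by blast
  then show ?thesis by (auto simp: colfin_def divisor_matrix_def)
qed

lemma mult_divisor_matrix:
  assumes "M i 0 = 0" "0 < j"
  shows "imat_mult M divisor_matrix i j = (\<Sum>d | d dvd j. M i d)"
proof -
  have "imat_mult M divisor_matrix i j = (\<Sum>d | d dvd j. M i d * divisor_matrix d j)"
    using assms by (intro imat_mult_eq_sum) (auto simp: divisor_matrix_def split: if_splits)
  also have "\<dots> = (\<Sum>d | d dvd j. M i d)"
    using assms by (intro sum.cong refl) (auto simp: divisor_matrix_def Suc_le_eq intro!: gr0I)
  finally show ?thesis .
qed

text \<open>Cancellation of the factor \<open>\<zeta>\<close>: the divisor \<open>j\<close> itself
  is the only one that induction does not cover.\<close>

lemma sum_divisors_inject:
  fixes f g :: "nat \<Rightarrow> 'a::ab_group_add"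
  assumes "\<And>j. 0 < j \<Longrightarrow> (\<Sum>d | d dvd j. f d) = (\<Sum>d | d dvd j. g d)" "0 < j"
  shows "f j = g j"
  using assms(2)
proof (induction j rule: less_induct)
  case (less j)
  have "{d. d dvd j} = insert j {d. d dvd j \<and> d < j}"
    using less.prems by (auto dest: dvd_imp_le)
  moreover have "finite {d. d dvd j \<and> d < j}" by auto
  ultimately have split: "(\<Sum>d | d dvd j. h d) = h j + (\<Sum>d | d dvd j \<and> d < j. h d)" for h :: "nat \<Rightarrow> 'a"
    by simp
  have "(\<Sum>d | d dvd j \<and> d < j. f d) = (\<Sum>d | d dvd j \<and> d < j. g d)"
    using less by (intro sum.cong refl less.IH) (auto intro!: gr0I)
  then show ?case using assms(1)[OF less.prems] by (simp add: split)
qed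

lemma sum_inverse_squares: "(\<Sum>e\<in>{2..n}. 1 / (real e)\<^sup>2) \<le> 1"
proof (cases "n = 0")
  case False
  then have "0 < n" by simp
  \<comment> \<open>Telescoping, as
    \<open>1 / (n + 1)\<^sup>2 \<le> 1 / n - 1 / (n + 1)\<close>.\<close>
  then have "(\<Sum>e\<in>{2..n}. 1 / (real e)\<^sup>2) \<le> 1 - 1 / real n"
  proof (induction n rule: nat_induct_non_zero)
    case (Suc n)
    have "1 / (real (Suc n))\<^sup>2 \<le> 1 / real n - 1 / real (Suc n)"
      using Suc by (simp add: divide_simps power2_eq_square)
    then show ?case using Suc by (cases "n = 0") auto
  qed auto
  then show ?thesis using False by (smt (verit) divide_nonneg_nonneg of_nat_0_le_iff)
qed auto

text \<open>Writing \<open>d = j / e\<close> with \<open>e \<ge> 2\<close> gives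
  \<open>1 / e\<^sup>3 \<le> 1 / (2 * e\<^sup>2)\<close>. The factor 1/2 is what lets a cubic bound
  survive the two summands in the recursion of \<open>to_model\<close>.\<close>

lemma sum_proper_divisors_cube:
  assumes "0 < j"
  shows "(\<Sum>d | d dvd j \<and> d < j. (real d) ^ 3) \<le> (real j) ^ 3 / 2"
proof -
  let ?P = "{d. d dvd j \<and> d < j}"
  have inj: "inj_on (\<lambda>d. j div d) ?P"
    using assms by (intro inj_on_inverseI[where g = "\<lambda>e. j div e"]) (auto elim!: dvdE)
  have sub: "(\<lambda>d. j div d) ` ?P \<subseteq> {2..j}"
    using assms by (auto elim!: dvdE)
  have "(\<Sum>d\<in>?P. (real d) ^ 3) = (\<Sum>d\<in>?P. (real j / real (j div d)) ^ 3)"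
    using assms by (intro sum.cong refl) (auto elim!: dvdE)
  also have "\<dots> = (\<Sum>e\<in>(\<lambda>d. j div d) ` ?P. (real j / real e) ^ 3)"
    by (simp add: sum.reindex[OF inj])
  also have "\<dots> \<le> (\<Sum>e\<in>{2..j}. (real j / real e) ^ 3)"
    using sub by (intro sum_mono2) auto
  also have "\<dots> \<le> (\<Sum>e\<in>{2..j}. (real j) ^ 3 / 2 * (1 / (real e)\<^sup>2))"
    by (intro sum_mono) (auto simp: field_simps power2_eq_square power3_eq_cube mult_left_mono)
  also have "\<dots> = (real j) ^ 3 / 2 * (\<Sum>e\<in>{2..j}. 1 / (real e)\<^sup>2)"
    by (simp add: sum_distrib_left)
  also have "\<dots> \<le> (real j) ^ 3 / 2 * 1"
    by (intro mult_left_mono sum_inverse_squares) auto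
  finally show ?thesis by simp
qed

text \<open>Row \<open>m\<close> (odd) is the Dirichlet series \<open>m\<^sup>-\<^sup>s\<close>. With \<open>x = \<zeta> - 1\<close> and \<open>y = x\<^sup>2 / \<zeta>\<close>, row
  \<open>position m c 1\<close> is \<open>m\<^sup>-\<^sup>s y\<^sup>c\<close> and row \<open>position m c 2\<close> is \<open>m\<^sup>-\<^sup>s y\<^sup>c x\<close>: one passes from the first to
  the second by multiplication with \<open>x\<close>, and from \<open>f = m\<^sup>-\<^sup>s y\<^sup>c x\<close> to \<open>g = m\<^sup>-\<^sup>s y\<^sup>c\<^sup>+\<^sup>1\<close> by
  solving \<open>g = x f - x g\<close>.\<close>
function to_model :: imat where
  "to_model i j = (if i = 0 \<or> j = 0 then 0 else if odd i then of_bool (i = j)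
     else if slot i = 2 then (\<Sum>d | d dvd j \<and> d < j. to_model (i div 2) d)
     else (\<Sum>d | d dvd j \<and> d < j. to_model (i div 2) d - to_model i d))"
  by auto
termination by (relation "measures [fst, snd]") auto

declare to_model.simps [simp del]

lemma to_model_0: "to_model 0 j = 0" "to_model i 0 = 0"
  by (simp_all add: to_model.simps)

lemma to_model_odd: "odd i \<Longrightarrow> to_model i j = of_bool (i = j)"
  by (auto simp: to_model.simps[of i j] odd_pos)

text \<open>Triangularity survives the recursion because halving the row index is matched by proper
  divisors of \<open>j\<close>, which are at most \<open>j / 2\<close>.\<close>

lemma to_model_nonzeroD: "to_model i j \<noteq> 0 \<Longrightarrow> 0 < i \<and> 0 < j \<and> i \<le> j"
proof (induction i j rule: to_model.induct)
  case (1 i j)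
  from "1.prems" have pos: "0 < i" "0 < j" by (auto simp: to_model_0 intro!: gr0I)
  have half: "i \<le> 2 * (i div 2)" if "even i" using that by auto
  have dvd: "2 * d \<le> j" if "d dvd j" "d < j" for d
    using that by (auto elim!: dvdE)
  show ?case
  proof (rule ccontr)
    assume *: "\<not> ?case"
    then have "j < i" using pos by auto
    have "to_model (i div 2) d = 0" if "even i" "d dvd j" "d < j" for d
      using "1.IH"(1,2)[of d] that dvd[of d] half pos \<open>j < i\<close> by fastforce
    moreover have "to_model i d = 0" if "even i" "slot i \<noteq> 2" "d dvd j" "d < j" for d
      using "1.IH"(3)[of d] that pos \<open>j < i\<close> by fastforce
    ultimately have "to_model i j = 0"
      using \<open>j < i\<close> by (subst to_model.simps) auto
    then show False using "1.prems" by simp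
  qed
qed

lemma to_model_Ints: "to_model i j \<in> \<int>"
proof (induction i j rule: to_model.induct)
  case (1 i j)
  then show ?case by (subst to_model.simps) (auto intro!: Ints_sum Ints_diff)
qed

lemma norm_to_model_le: "norm (to_model i j) \<le> (real j) ^ 3"
proof (induction i j rule: to_model.induct)
  case (1 i j)
  consider "i = 0 \<or> j = 0" | "0 < j" "odd i" | "0 < i" "0 < j" "even i" "slot i = 2" | "0 < i" "0 < j" "even i" "slot i \<noteq> 2"
    by auto
  then show ?case
  proof cases
    case 3
    have "norm (to_model i j) \<le> (\<Sum>d | d dvd j \<and> d < j. (real d) ^ 3)"
      using 3 by (subst to_model.simps) (auto intro!: sum_norm_le "1.IH"(1))
    also have "\<dots> \<le> (real j) ^ 3"
      by (rule order_trans[OF sum_proper_divisors_cube[OF 3(2)]]) simp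
    finally show ?thesis .
  next
    case 4
    have "norm (to_model i j) \<le> (\<Sum>d | d dvd j \<and> d < j. (real d) ^ 3 + (real d) ^ 3)"
    proof -
      have eq: "to_model i j = (\<Sum>d | d dvd j \<and> d < j. to_model (i div 2) d - to_model i d)"
        using 4 by (subst to_model.simps) simp
      show ?thesis
        unfolding eq using 4
        by (intro sum_norm_le order_trans[OF norm_triangle_ineq4] add_mono "1.IH"(2,3)) auto
    qed
    also have "\<dots> \<le> (real j) ^ 3" using sum_proper_divisors_cube[OF 4(2)] unfolding sum.distrib by simp
    finally show ?thesis .
  qed (auto simp: to_model_0 to_model_odd)
qed

lemma to_model_int_poly: "to_model \<in> int_poly_mats"
proof (rule int_poly_matsI[of _ 3])
  fix i j assume nz: "to_model i j \<noteq> 0"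
  have "i \<le> (j + 1) ^ 1" using to_model_nonzeroD[OF nz] by simp
  also have "\<dots> \<le> (j + 1) ^ 3" by (intro power_increasing) auto
  finally have "i \<le> (j + 1) ^ 3" .
  moreover have "norm (to_model i j) \<le> real ((j + 1) ^ 3)"
    using norm_to_model_le[of i j] by (rule order_trans) (simp add: power_mono)
  ultimately show "0 < i \<and> 0 < j \<and> i \<le> (j + 1) ^ 3 \<and> to_model i j \<in> \<int> \<and> norm (to_model i j) \<le> real ((j + 1) ^ 3)"
    using to_model_nonzeroD[OF nz] to_model_Ints by blast
qed

lemma to_model_colfin: "to_model \<in> colfin"
  by (intro int_poly_mats_colfin to_model_int_poly)

lemma to_model_double_1:
  assumes "0 < i" "0 < j" "slot i = 1"
  shows "to_model (2 * i) j = (\<Sum>d | d dvd j \<and> d < j. to_model i d)"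
  using assms by (subst to_model.simps) (simp add: slot_double)

lemma to_model_double_2:
  assumes "0 < i" "0 < j" "slot i = 2"
  shows "to_model (2 * i) j = (\<Sum>d | d dvd j \<and> d < j. to_model i d - to_model (2 * i) d)"
  using assms by (subst to_model.simps) (simp add: slot_double two_neq_one)

text \<open>Multiplying a row \<open>f\<close> by \<open>\<zeta> = 1 + x\<close> gives
  \<open>f + x f\<close>. In slot 1, \<open>x f\<close> is row \<open>2 * i\<close>. In slot 2, with
  \<open>g\<close> the row \<open>2 * i\<close>, the defining equation reads
  \<open>x f = g + x g\<close>, and \<open>x g\<close> is row \<open>4 * i\<close>.\<close>

lemma to_model_divisor: "imat_mult to_model divisor_matrix = imat_mult (lift T_fps) to_model"
proof (intro ext)
  fix i j :: nat
  consider "i = 0" | "j = 0" | "0 < i" "0 < j" by auto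
  then show "imat_mult to_model divisor_matrix i j = imat_mult (lift T_fps) to_model i j"
  proof cases
    case 3
    have "{d. d dvd j} = insert j {d. d dvd j \<and> d < j}"
      using 3 by (auto dest: dvd_imp_le)
    moreover have "finite {d. d dvd j \<and> d < j}" by auto
    ultimately have *: "imat_mult to_model divisor_matrix i j = to_model i j + (\<Sum>d | d dvd j \<and> d < j. to_model i d)"
      using 3 by (simp add: mult_divisor_matrix to_model_0)
    show ?thesis
    proof (cases i rule: slot_cases)
      case 1
      then show ?thesis
        using 3 by (simp add: * lift_T_mult to_model_colfin to_model_double_1 two_neq_one)
    next
      case 2
      have "to_model (4 * i) j = (\<Sum>d | d dvd j \<and> d < j. to_model (2 * i) d)"
        using to_model_double_1[of "2 * i" j] 3 2 by (simp add: slot_double two_neq_one)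
      then show ?thesis
        using 3 2 by (simp add: * lift_T_mult to_model_colfin to_model_double_2 sum_subtractf)
    qed
  qed (simp_all add: imat_mult_def to_model_0 lift_def divisor_matrix_def)
qed

section \<open>Passing back from the model\<close>

text \<open>Row \<open>i\<close> is the Dirichlet series \<open>\<lambda>\<close> times
  \<open>i\<^sup>-\<^sup>s\<close>, where \<open>\<lambda>\<close> is the sum of
  \<open>r\<^sup>-\<^sup>s\<close> over odd \<open>r\<close>.\<close>

definition odd_multiples :: imat where
  "odd_multiples i j = of_bool (0 < j \<and> i dvd j \<and> odd (j div i))"

lemma odd_multiples_nonzeroD:
  assumes "odd_multiples i k \<noteq> 0"
  shows "0 < i" "i \<le> k" "k \<noteq> i \<Longrightarrow> 3 * i \<le> k" "odd i \<Longrightarrow> odd k" "k \<in> (\<lambda>r. r * i) ` {1..k}"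
proof -
  obtain r where r: "k = i * r" "0 < k" using assms by (auto simp: odd_multiples_def elim: dvdE)
  then have i: "0 < i" "odd r" using assms by (auto simp: odd_multiples_def intro!: gr0I)
  then show "0 < i" by simp
  have "r \<ge> 1" using i by (auto intro!: gr0I simp: Suc_le_eq)
  then show "i \<le> k" using r by simp
  have "r \<ge> 3" if "r \<noteq> 1"
    using that i(2) \<open>r \<ge> 1\<close> by (cases "r = 2") auto
  then show "3 * i \<le> k" if "k \<noteq> i" using that r by (cases "r = 1") auto
  show "odd k" if "odd i" using that i r by simp
  have "r \<le> k" using r i by simp
  then show "k \<in> (\<lambda>r. r * i) ` {1..k}" using r \<open>r \<ge> 1\<close> by (intro image_eqI[of _ _ r]) auto
qed

lemma odd_multiples_colfin: "odd_multiples \<in> colfin"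
proof -
  have "{i. odd_multiples i j \<noteq> 0} \<subseteq> {..j}" for j
    using odd_multiples_nonzeroD(2) by auto
  then have "finite {i. odd_multiples i j \<noteq> 0}" for j
    using finite_subset by blast
  then show ?thesis by (auto simp: colfin_def odd_multiples_def)
qed

text \<open>Write \<open>q = 2\<^sup>-\<^sup>s\<close> and \<open>\<lambda> = \<Sum> m\<^sup>-\<^sup>s\<close> over odd \<open>m\<close>. Then \<open>\<zeta> = \<lambda> / (1 - q)\<close>, so \<open>q = 1 - \<lambda> \<zeta>\<^sup>-\<^sup>1\<close>;
  row \<open>m\<close> (odd) of the \<open>a\<close>-th matrix below expands \<open>m\<^sup>-\<^sup>s q\<^sup>a\<close> in the rows of \<^const>\<open>to_model\<close>.\<close>
fun dyadic_rows :: "nat \<Rightarrow> imat" where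
  "dyadic_rows 0 = imat_one"
| "dyadic_rows (Suc a) = (\<lambda>i j. dyadic_rows a i j
     - imat_mult odd_multiples (imat_mult (dyadic_rows a) (lift T_inv_fps)) i j)"

lemma lift_T_int_poly: "lift T_fps \<in> int_poly_mats"
proof (rule lift_int_poly)
  fix a b :: 2 and k
  have "(1::int) \<le> 4 ^ k" by simp
  then have "(1::int) \<le> 2 * 4 ^ k" by linarith
  then show "\<bar>fps_nth (vec_nth (vec_nth T_fps a) b) k\<bar> \<le> 2 * 4 ^ k"
    using exhaust_2[of a] exhaust_2[of b] by (auto simp: T_fps_def)
qed

lemma lift_T_inv_int_poly: "lift T_inv_fps \<in> int_poly_mats"
proof (rule lift_int_poly)
  fix a b :: 2 and k
  have "(1::int) \<le> 4 ^ k" by simp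
  then have "(1::int) \<le> 2 * 4 ^ k" by linarith
  then show "\<bar>fps_nth (vec_nth (vec_nth T_inv_fps a) b) k\<bar> \<le> 2 * 4 ^ k"
    using exhaust_2[of a] exhaust_2[of b] by (auto simp: T_inv_fps_def)
qed

lemma lift_S_int_poly: "lift S_fps \<in> int_poly_mats"
proof (rule lift_int_poly)
  fix a b :: 2 and k
  have "\<bar>fps_nth (1 + fps_X * catalan_fps) k\<bar> \<le> 2 * 4 ^ k"
  proof (cases k)
    case (Suc n)
    have "\<bar>signed_catalan n\<bar> \<le> 2 * 4 ^ n" by (rule signed_catalan_bound)
    then show ?thesis using Suc by (simp add: catalan_fps_def)
  qed simp
  then show "\<bar>fps_nth (vec_nth (vec_nth S_fps a) b) k\<bar> \<le> 2 * 4 ^ k"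
    using exhaust_2[of a] exhaust_2[of b] signed_catalan_bound[of k]
    by (auto simp: S_fps_def catalan_fps_def)
qed

lemmas lift_T_inv_colfin = int_poly_mats_colfin[OF lift_T_inv_int_poly]

lemma dyadic_rows_0_right: "dyadic_rows a i 0 = 0"
  by (induction a arbitrary: i) (auto simp: imat_one_def imat_mult_def lift_def)

text \<open>Leading terms cancel: if \<open>j < 2 ^ Suc a * i\<close>, only \<open>k = i\<close>
  contributes to the product with \<open>odd_multiples\<close>, since any other \<open>k\<close> is
  at least \<open>3 * i\<close>. This term removes \<open>dyadic_rows a i j\<close> and leaves
  entries at \<open>j div 2\<close> and \<open>j div 4\<close>, which vanish by induction.\<close>

lemma dyadic_rows_nonzeroD: "dyadic_rows a i j \<noteq> 0 \<Longrightarrow> 0 < i \<and> 0 < j \<and> 2 ^ a * i \<le> j"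
proof (induction a arbitrary: i j)
  case 0
  then show ?case by (auto simp: imat_one_def split: if_splits)
next
  case (Suc a)
  let ?P = "imat_mult (dyadic_rows a) (lift T_inv_fps)"
  have j: "0 < j" using Suc.prems dyadic_rows_0_right[of "Suc a" i] by (auto intro!: gr0I)
  have i: "0 < i"
  proof (rule ccontr)
    assume "\<not> 0 < i"
    then have "dyadic_rows a i j = 0" "imat_mult odd_multiples ?P i j = 0"
      using Suc.IH[of i j] imat_mult_nonzero[of odd_multiples ?P i j] odd_multiples_nonzeroD(1) by blast+
    then show False using Suc.prems by simp
  qed
  have P: "?P k j = dyadic_rows a k j - (if even j then dyadic_rows a k (j div 2) else 0)
     + (if slot j = 1 \<and> 4 dvd j then dyadic_rows a k (j div 4) else 0)" for k
    by (intro mult_lift_T_inv dyadic_rows_0_right j)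
  have P_nz: "2 ^ a * k \<le> j" if "?P k j \<noteq> 0" for k
  proof -
    have "\<exists>j'\<le>j. dyadic_rows a k j' \<noteq> 0"
      using that unfolding P by (rule contrapos_np) auto
    then show ?thesis using Suc.IH[of k] by fastforce
  qed
  have "2 ^ Suc a * i \<le> j"
  proof (rule ccontr)
    assume *: "\<not> 2 ^ Suc a * i \<le> j"
    have "odd_multiples i k * ?P k j = 0" if "k \<noteq> i" for k
    proof (rule ccontr)
      assume "odd_multiples i k * ?P k j \<noteq> 0"
      then have "3 * i \<le> k" "2 ^ a * k \<le> j" using odd_multiples_nonzeroD(3)[of i k] P_nz that by auto
      then have "2 ^ a * (3 * i) \<le> j" by (meson mult_le_mono2 order_trans)
      then show False using * by simp
    qed
    then have "imat_mult odd_multiples ?P i j = (\<Sum>k | ?P k j \<noteq> 0. if k = i then ?P k j else 0)"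
      unfolding imat_mult_def[of odd_multiples] using i
      by (intro sum.cong refl) (auto simp: odd_multiples_def)
    also have "\<dots> = ?P i j"
    proof -
      have "k \<le> j" if "?P k j \<noteq> 0" for k
        using P_nz[OF that] order_trans[of k "2 ^ a * k" j] by simp
      then have "{k. ?P k j \<noteq> 0} \<subseteq> {..j}" by blast
      then have "finite {k. ?P k j \<noteq> 0}" by (rule finite_subset) simp
      then show ?thesis by (simp add: sum.delta)
    qed
    finally have eq: "dyadic_rows (Suc a) i j = (if even j then dyadic_rows a i (j div 2) else 0)
       - (if slot j = 1 \<and> 4 dvd j then dyadic_rows a i (j div 4) else 0)"
      by (simp add: P)
    have "dyadic_rows a i (j div 2) = 0" "dyadic_rows a i (j div 4) = 0"
      using Suc.IH[of i "j div 2"] Suc.IH[of i "j div 4"] * by fastforce+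
    then show False using Suc.prems unfolding eq by (auto split: if_splits)
  qed
  then show ?case using i j by simp
qed

lemma dyadic_rows_colfin: "dyadic_rows a \<in> colfin"
proof -
  have "i \<le> j" if "dyadic_rows a i j \<noteq> 0" for i j
    using dyadic_rows_nonzeroD[OF that] by (metis mult_le_mono1 nat_mult_1 one_le_numeral one_le_power order_trans)
  then have "{i. dyadic_rows a i j \<noteq> 0} \<subseteq> {..j}" for j by auto
  then have "finite {i. dyadic_rows a i j \<noteq> 0}" for j
    using finite_subset by blast
  then show ?thesis using dyadic_rows_nonzeroD by (fastforce simp: colfin_def)
qed

lemma dyadic_rows_Ints: "dyadic_rows a i j \<in> \<int>"
proof (induction a arbitrary: i j)
  case 0
  show ?case by (simp add: imat_one_def)
next
  case (Suc a)
  then show ?case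
    by (auto simp: imat_mult_def odd_multiples_def intro!: Ints_diff Ints_sum Ints_mult
        int_poly_mats_Ints[OF lift_T_inv_int_poly])
qed

text \<open>The factor is \<open>7 = 1 + 3 * 2\<close>: multiplication by
  \<open>lift T_inv_fps\<close> adds at most three terms, and the square in \<open>j / i\<close>
  makes the sum over multiples \<open>k = r * i\<close> at most twice its first term.\<close>

lemma norm_dyadic_rows_le: "norm (dyadic_rows a i j) \<le> 7 ^ a * (real j / real i)\<^sup>2"
proof (induction a arbitrary: i j)
  case 0
  show ?case by (auto simp: imat_one_def)
next
  case (Suc a)
  let ?P = "imat_mult (dyadic_rows a) (lift T_inv_fps)"
  consider "i = 0 \<or> j = 0" | "0 < i" "0 < j" by auto
  then show ?case
  proof cases
    case 1
    then have "dyadic_rows (Suc a) i j = 0" using dyadic_rows_nonzeroD[of "Suc a" i j] by blast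
    then show ?thesis by simp
  next
    case 2
    let ?b = "\<lambda>k. 7 ^ a * (real j / real k)\<^sup>2"
    have P: "norm (?P k j) \<le> 3 * ?b k" for k
    proof -
      have *: "norm (dyadic_rows a k j') \<le> ?b k" if "j' \<le> j" for j'
        by (rule order_trans[OF Suc.IH]) (use that in \<open>auto intro!: mult_left_mono power_mono divide_right_mono\<close>)
      have nn: "?b k \<ge> 0" by simp
      have 1: "norm (if even j then dyadic_rows a k (j div 2) else 0) \<le> ?b k"
        and 2: "norm (if slot j = 1 \<and> 4 dvd j then dyadic_rows a k (j div 4) else 0) \<le> ?b k"
        using *[of "j div 2"] *[of "j div 4"] nn by auto
      have "norm (?P k j) \<le> norm (dyadic_rows a k j) + norm (if even j then dyadic_rows a k (j div 2) else 0)
         + norm (if slot j = 1 \<and> 4 dvd j then dyadic_rows a k (j div 4) else 0)"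
        unfolding mult_lift_T_inv[of "dyadic_rows a", OF dyadic_rows_0_right \<open>0 < j\<close>]
        by (rule order_trans[OF norm_triangle_ineq add_right_mono[OF norm_triangle_ineq4]])
      then show ?thesis using *[of j] 1 2 by linarith
    qed
    have P_nz: "k \<in> {..j}" if nz: "?P k j \<noteq> 0" for k
    proof -
      obtain l where l: "dyadic_rows a k l \<noteq> 0" "lift T_inv_fps l j \<noteq> 0"
        using imat_mult_nonzero[OF nz] by blast
      have "k \<le> l" using dyadic_rows_nonzeroD[OF l(1)]
        by (metis mult_le_mono1 nat_mult_1 one_le_numeral one_le_power order_trans)
      moreover have "l \<le> j"
        using lift_T_inv_fps[OF 2(2), of l] lift_nonzeroD(1)[OF l(2)] l(2) by (auto simp: of_bool_def split: if_splits)
      ultimately show ?thesis by simp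
    qed
    let ?R = "(\<lambda>r. r * i) ` {1..j}"
    have in_R: "k \<in> ?R" if "odd_multiples i k \<noteq> 0" "k \<le> j" for k
    proof -
      have "(\<lambda>r. r * i) ` {1..k} \<subseteq> ?R" using that(2) by (intro image_mono) auto
      then show ?thesis using odd_multiples_nonzeroD(5)[OF that(1)] by blast
    qed
    have "imat_mult odd_multiples ?P i j = (\<Sum>k\<in>{..j}. odd_multiples i k * ?P k j)"
      using P_nz by (intro imat_mult_eq_sum) auto
    also have "\<dots> = (\<Sum>k\<in>{..j} \<inter> ?R. odd_multiples i k * ?P k j)"
    proof (rule sum.mono_neutral_right)
      show "\<forall>k\<in>{..j} - ({..j} \<inter> ?R). odd_multiples i k * ?P k j = 0"
        using in_R by (metis DiffE IntI atMost_iff mult_zero_left)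
    qed auto
    also have "norm \<dots> \<le> (\<Sum>k\<in>{..j} \<inter> ?R. 3 * ?b k)"
    proof (intro sum_norm_le)
      fix k
      have "norm (odd_multiples i k * ?P k j) \<le> norm (?P k j)"
        by (simp add: odd_multiples_def norm_mult)
      then show "norm (odd_multiples i k * ?P k j) \<le> 3 * ?b k" using P[of k] by linarith
    qed
    also have "\<dots> \<le> (\<Sum>k\<in>?R. 3 * ?b k)" by (intro sum_mono2) auto
    also have "\<dots> = (\<Sum>r\<in>{1..j}. 3 * ?b i * (1 / (real r)\<^sup>2))"
      using 2 by (subst sum.reindex) (auto simp: inj_on_def power_divide power_mult_distrib field_simps intro!: sum.cong)
    also have "\<dots> = 3 * ?b i * (\<Sum>r\<in>{1..j}. 1 / (real r)\<^sup>2)" by (simp add: sum_distrib_left)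
    also have "(\<Sum>r\<in>{1..j}. 1 / (real r)\<^sup>2) = 1 + (\<Sum>r\<in>{2..j}. 1 / (real r)\<^sup>2)"
      using 2 by (subst sum.atLeast_Suc_atMost) (auto simp: numeral_2_eq_2)
    also have "3 * ?b i * (1 + (\<Sum>r\<in>{2..j}. 1 / (real r)\<^sup>2)) \<le> 3 * ?b i * (1 + 1)"
      by (intro mult_left_mono add_left_mono sum_inverse_squares) auto
    finally have "norm (imat_mult odd_multiples ?P i j) \<le> 6 * ?b i" by simp
    then have "norm (dyadic_rows (Suc a) i j) \<le> ?b i + 6 * ?b i"
      using Suc.IH[of i j] norm_triangle_ineq4[of "dyadic_rows a i j" "imat_mult odd_multiples ?P i j"]
      by simp
    then show ?thesis by simp
  qed
qed

text \<open>For \<open>i = m * 2 ^ v\<close> with \<open>m\<close> odd, row \<open>i\<close> expands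
  \<open>i\<^sup>-\<^sup>s = m\<^sup>-\<^sup>s q\<^sup>v\<close> in the rows of
  \<open>to_model\<close>.\<close>

definition from_model :: imat where
  "from_model i j = (if i = 0 then 0 else dyadic_rows (multiplicity 2 i) (odd_part i) j)"

lemma from_model_nonzeroD:
  assumes "from_model i j \<noteq> 0"
  shows "0 < i" "0 < j" "i \<le> j"
proof -
  show "0 < i" using assms by (auto simp: from_model_def intro!: gr0I)
  then show "0 < j" "i \<le> j"
    using assms dyadic_rows_nonzeroD[of "multiplicity 2 i" "odd_part i" j] odd_part_times[of i]
    by (auto simp: from_model_def mult.commute)
qed

lemma from_model_int_poly: "from_model \<in> int_poly_mats"
proof (rule int_poly_matsI[of _ 5])
  fix i j assume nz: "from_model i j \<noteq> 0"
  note * = from_model_nonzeroD[OF nz]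
  let ?v = "multiplicity 2 i"
  have m: "odd_part i \<ge> 1" using odd_odd_part[OF *(1)] by (auto simp: Suc_le_eq odd_pos)
  have "2 ^ ?v \<le> odd_part i * 2 ^ ?v" using m by simp
  then have "2 ^ ?v \<le> j" using odd_part_times[OF *(1)] *(3) by simp
  then have v: "2 ^ ?v \<le> real j" by (metis of_nat_le_iff of_nat_numeral of_nat_power)
  have "norm (from_model i j) \<le> 7 ^ ?v * (real j / real (odd_part i))\<^sup>2"
    using * norm_dyadic_rows_le by (simp add: from_model_def)
  \<comment> \<open>Since \<open>7 < 2 ^ 3\<close> and \<open>2 ^ ?v \<le> j\<close>, the
    exponential factor costs only \<open>j ^ 3\<close>.\<close>
  also have "\<dots> \<le> 8 ^ ?v * (real j)\<^sup>2"
    using m by (intro mult_mono power_mono) (auto simp: divide_le_eq mult_le_cancel_left1)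
  also have "(8::real) ^ ?v = (2 ^ ?v) ^ 3" by (simp flip: power_mult power_mult_distrib add: mult.commute power_mult[of 2 3])
  also have "\<dots> * (real j)\<^sup>2 \<le> real j ^ 3 * (real j)\<^sup>2" using v by (intro mult_right_mono power_mono) auto
  also have "\<dots> = real j ^ 5" by (simp flip: power_add)
  also have "\<dots> \<le> real ((j + 1) ^ 5)" by (simp add: power_mono)
  finally have "norm (from_model i j) \<le> real ((j + 1) ^ 5)" .
  moreover have "i \<le> (j + 1) ^ 5"
    using *(3) self_le_power[of "j + 1" 5] by simp
  moreover have "from_model i j \<in> \<int>" using * by (simp add: from_model_def dyadic_rows_Ints)
  ultimately show "0 < i \<and> 0 < j \<and> i \<le> (j + 1) ^ 5 \<and> from_model i j \<in> \<int> \<and> norm (from_model i j) \<le> real ((j + 1) ^ 5)"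
    using * by blast
qed

lemma from_model_colfin: "from_model \<in> colfin"
  by (intro int_poly_mats_colfin from_model_int_poly)

lemma lift_T_inv_to_model_divisor:
  "imat_mult (imat_mult (lift T_inv_fps) to_model) divisor_matrix = to_model"
proof -
  have "imat_mult (imat_mult (lift T_inv_fps) to_model) divisor_matrix
     = imat_mult (imat_mult (lift T_inv_fps) (lift T_fps)) to_model"
    by (simp add: imat_mult_assoc to_model_colfin divisor_matrix_colfin to_model_divisor
        int_poly_mats_colfin[OF lift_T_int_poly])
  then show ?thesis
    by (simp add: lift_mult T_fps_inverse lift_one imat_one_mult to_model_colfin)
qed

lemma divisor_matrix_eq_sum: "0 < n \<Longrightarrow> 0 < j \<Longrightarrow> divisor_matrix n j = (\<Sum>d | d dvd j. imat_one n d)"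
  using mult_divisor_matrix[of imat_one n j] by (simp add: imat_one_mult divisor_matrix_colfin) (simp add: imat_one_def)

text \<open>The induction step is checked after multiplication by \<open>\<zeta>\<close>: it becomes
  \<open>\<zeta> q\<^sup>a - \<lambda> q\<^sup>a = \<zeta> q\<^sup>a\<^sup>+\<^sup>1\<close>, that
  is, multiples of \<open>n\<close> without the odd multiples are the multiples of
  \<open>2 * n\<close>. For odd \<open>m\<close> the odd multiples are odd, so the induction
  hypothesis covers them.\<close>

lemma dyadic_rows_to_model:
  "odd m \<Longrightarrow> imat_mult (dyadic_rows a) to_model m j = imat_one (2 ^ a * m) j"
proof (induction a arbitrary: m j)
  case 0
  have "imat_mult (dyadic_rows 0) to_model m j = to_model m j"
    by (simp add: imat_one_mult to_model_colfin)
  then show ?case using 0 by (auto simp: to_model_odd imat_one_def odd_pos Suc_le_eq)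
next
  case (Suc a)
  define X where "X = (\<lambda>a. imat_mult (dyadic_rows a) to_model)"
  let ?n = "2 ^ a * m"
  have pos: "0 < m" "0 < ?n" using Suc.prems by (auto simp: odd_pos)
  have Xc: "X a \<in> colfin" for a
    unfolding X_def by (intro imat_mult_colfin dyadic_rows_colfin to_model_colfin)
  have "imat_mult (imat_mult odd_multiples (imat_mult (dyadic_rows a) (lift T_inv_fps))) (imat_mult to_model divisor_matrix)
     = imat_mult odd_multiples (imat_mult (dyadic_rows a) (imat_mult (imat_mult (lift T_inv_fps) to_model) divisor_matrix))"
    by (simp add: imat_mult_assoc imat_mult_colfin dyadic_rows_colfin to_model_colfin divisor_matrix_colfin
        odd_multiples_colfin lift_T_inv_colfin)
  then have XD: "imat_mult (X (Suc a)) divisor_matrix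
     = (\<lambda>i j. imat_mult (X a) divisor_matrix i j - imat_mult odd_multiples (X a) i j)"
    by (simp add: X_def imat_mult_assoc imat_mult_colfin to_model_colfin divisor_matrix_colfin
        imat_mult_diff_left lift_T_inv_to_model_divisor)
  have "X (Suc a) m j = imat_one (2 ^ Suc a * m) j" if "0 < j" for j
  proof (rule sum_divisors_inject[OF _ that])
    fix j :: nat assume j: "0 < j"
    have "(\<Sum>d | d dvd j. X (Suc a) m d) = imat_mult (X a) divisor_matrix m j - imat_mult odd_multiples (X a) m j"
      using mult_divisor_matrix[of "X (Suc a)" m j, OF colfinD(2)[OF Xc] j] by (simp add: XD)
    also have "imat_mult (X a) divisor_matrix m j = divisor_matrix ?n j"
      using Suc pos j by (simp add: mult_divisor_matrix colfinD(2)[OF Xc] divisor_matrix_eq_sum) (simp add: X_def)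
    also have "imat_mult odd_multiples (X a) m j = of_bool (?n dvd j \<and> odd (j div ?n))"
    proof -
      have term_eq: "odd_multiples m k * X a k j = (if 2 ^ a dvd j \<and> k = j div 2 ^ a then odd_multiples m k else 0)" for k
      proof (cases "odd_multiples m k = 0")
        case False
        then have "odd k" using odd_multiples_nonzeroD(4) Suc.prems by blast
        then have "X a k j = imat_one (2 ^ a * k) j" using Suc.IH by (simp add: X_def)
        moreover have "2 ^ a * k = j \<longleftrightarrow> 2 ^ a dvd j \<and> k = j div 2 ^ a" by auto
        ultimately show ?thesis using \<open>odd k\<close> j by (auto simp: imat_one_def)
      qed auto
      have "imat_mult odd_multiples (X a) m j = (\<Sum>k\<in>{k. X a k j \<noteq> 0} \<union> {j div 2 ^ a}. odd_multiples m k * X a k j)"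
        using colfinD(3)[OF Xc] by (intro imat_mult_eq_sum) auto
      also have "\<dots> = (if 2 ^ a dvd j then odd_multiples m (j div 2 ^ a) else 0)"
        using colfinD(3)[OF Xc, of a j] by (auto simp: term_eq sum.delta)
      also have "\<dots> = of_bool (?n dvd j \<and> odd (j div ?n))"
        using j by (auto simp: odd_multiples_def div_mult2_eq elim!: dvdE)
      finally show ?thesis .
    qed
    also have "divisor_matrix ?n j - of_bool (?n dvd j \<and> odd (j div ?n)) = divisor_matrix (2 ^ Suc a * m) j"
    proof -
      have "2 * ?n dvd j \<longleftrightarrow> ?n dvd j \<and> even (j div ?n)"
        using pos(2) by (auto elim!: dvdE)
      then show ?thesis using pos j by (auto simp: divisor_matrix_def mult.assoc Suc_le_eq)
    qed
    also have "\<dots> = (\<Sum>d | d dvd j. imat_one (2 ^ Suc a * m) d)"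
      using pos j by (intro divisor_matrix_eq_sum) auto
    finally show "(\<Sum>d | d dvd j. X (Suc a) m d) = (\<Sum>d | d dvd j. imat_one (2 ^ Suc a * m) d)" .
  qed
  moreover have "X (Suc a) m 0 = imat_one (2 ^ Suc a * m) 0"
    using colfinD(2)[OF Xc] pos by (simp add: imat_one_def)
  ultimately show ?case unfolding X_def by (metis not_gr0)
qed

lemma from_to_model: "imat_mult from_model to_model = imat_one"
proof (intro ext)
  fix i j
  show "imat_mult from_model to_model i j = imat_one i j"
  proof (cases "i = 0")
    case True
    then show ?thesis by (auto simp: imat_mult_def from_model_def imat_one_def)
  next
    case False
    have "imat_mult from_model to_model i j = imat_mult (dyadic_rows (multiplicity 2 i)) to_model (odd_part i) j"
      using False by (simp add: imat_mult_def from_model_def)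
    also have "\<dots> = imat_one i j"
      using False by (simp add: dyadic_rows_to_model odd_odd_part odd_part_times mult.commute[of "2 ^ _"])
    finally show ?thesis .
  qed
qed

lemma to_from_model: "imat_mult to_model from_model = imat_one"
  by (rule upper_triangular_inverse[OF from_model_colfin _ to_model_colfin _ from_to_model])
     (auto dest: from_model_nonzeroD to_model_nonzeroD)

section \<open>The filtration\<close>

lemma imat_act_add:
  assumes "u \<in> Espace" "v \<in> Espace"
  shows "imat_act M (\<lambda>n. u n + v n) i = imat_act M u i + imat_act M v i"
proof -
  let ?K = "{n. u n \<noteq> 0} \<union> {n. v n \<noteq> 0}"
  have K: "finite ?K" using assms by (auto simp: Espace_def)
  have "imat_act M w i = (\<Sum>j\<in>?K. M i j * w j)" if "{n. w n \<noteq> 0} \<subseteq> ?K" for w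
    using that K by (intro imat_act_eq_sum) auto
  note * = this[of u] this[of v] this[of "\<lambda>n. u n + v n"]
  have "{n. u n + v n \<noteq> 0} \<subseteq> ?K" by auto
  then show ?thesis using * by (simp add: sum.distrib distrib_left)
qed

lemma imat_act_scale: "imat_act M (\<lambda>n. a * v n) i = a * imat_act M v i"
  by (cases "a = 0") (simp_all add: imat_act_def sum_distrib_left mult.left_commute)

lemma imat_act_zero: "imat_act M (\<lambda>n. 0) = (\<lambda>n. 0)"
  by (simp add: imat_act_def)

lemma Espace_closed:
  "(\<lambda>n. 0) \<in> Espace"
  "u \<in> Espace \<Longrightarrow> v \<in> Espace \<Longrightarrow> (\<lambda>n. u n + v n) \<in> Espace"
  "v \<in> Espace \<Longrightarrow> (\<lambda>n. a * v n) \<in> Espace"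
proof -
  show "(\<lambda>n. 0) \<in> Espace" by (simp add: Espace_def)
  show "(\<lambda>n. a * v n) \<in> Espace" if "v \<in> Espace"
    using that by (auto simp: Espace_def)
  show "(\<lambda>n. u n + v n) \<in> Espace" if "u \<in> Espace" "v \<in> Espace"
  proof -
    have "{n. u n + v n \<noteq> 0} \<subseteq> {n. u n \<noteq> 0} \<union> {n. v n \<noteq> 0}" by auto
    then have "finite {n. u n + v n \<noteq> 0}"
      by (rule finite_subset) (use that in \<open>auto simp: Espace_def\<close>)
    then show ?thesis using that by (simp add: Espace_def)
  qed
qed

definition base :: "nat \<Rightarrow> nat" where
  "base k = odd_part k * 4 ^ level k"

text \<open>One representative for each two-dimensional block; the filtration adds blocks in
  increasing order of it.\<close>

definition bases :: "nat set" where
  "bases = {n. 0 < n \<and> slot n = 1}"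

lemma base_eq_position: "base k = position (odd_part k) (level k) 1"
  by (simp add: base_def position_def)

lemma base_in_bases: "0 < k \<Longrightarrow> base k \<in> bases"
  by (simp add: bases_def base_eq_position slot_position odd_odd_part position_pos)

lemma base_position: "odd m \<Longrightarrow> base (position m c a) = position m c 1"
  by (simp add: base_eq_position odd_part_position level_position)

lemma base_eqD:
  assumes "odd m" "0 < k" "base k = position m c 1"
  shows "k = position m c (slot k)"
proof -
  have "odd_part k = m" "level k = c"
    using assms odd_part_position level_position odd_odd_part unfolding base_eq_position by metis+
  then show ?thesis using position_collapse[OF assms(2)] by simp
qed

text \<open>This makes the order of the blocks compatible with all lifted matrices, hence the
  filtration stable.\<close>

lemma base_lift_mono: "lift M i j \<noteq> 0 \<Longrightarrow> base i \<le> base j"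
  using lift_nonzeroD[of M i j] by (auto simp: base_def intro!: mult_left_mono power_increasing)

lemma infinite_bases: "infinite bases"
proof -
  have "position 1 c 1 \<in> bases" for c
    by (simp add: bases_def slot_position position_pos)
  then have "range (\<lambda>c. position 1 c 1) \<subseteq> bases" by blast
  moreover have "inj (\<lambda>c. position 1 c 1)"
    by (rule inj_on_inverseI[where g = level]) (simp add: level_position)
  ultimately show ?thesis using finite_subset range_inj_infinite by blast
qed

lemma base_less_enumerate_Suc:
  assumes "0 < k"
  shows "base k < enumerate bases (Suc i) \<longleftrightarrow> base k \<le> enumerate bases i"
proof -
  obtain n where "enumerate bases n = base k"
    using enumerate_Ex[OF infinite_bases base_in_bases[OF assms]] by blast
  then show ?thesis
    using enumerate_mono_iff[OF infinite_bases, of n "Suc i"] enumerate_mono_iff[OF infinite_bases, of i n]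
    by (metis less_Suc_eq_le not_le)
qed

definition coords :: "ivec \<Rightarrow> ivec" where
  "coords v = imat_act to_model v"

lemma coords_in_Espace: "v \<in> Espace \<Longrightarrow> coords v \<in> Espace"
  unfolding coords_def by (intro imat_act_in_Espace to_model_colfin)

lemma from_model_coords: "v \<in> Espace \<Longrightarrow> imat_act from_model (coords v) = v"
  unfolding coords_def
  by (simp add: imat_act_assoc[symmetric] to_model_colfin from_to_model imat_one_act)

lemma coords_from_model: "u \<in> Espace \<Longrightarrow> coords (imat_act from_model u) = u"
  unfolding coords_def
  by (simp add: imat_act_assoc[symmetric] from_model_colfin to_from_model imat_one_act)

definition conjugate :: "imat \<Rightarrow> imat" where
  "conjugate A = imat_mult from_model (imat_mult A to_model)"

lemma conjugate_mult:
  assumes "A \<in> colfin" "B \<in> colfin"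
  shows "imat_mult (conjugate A) (conjugate B) = conjugate (imat_mult A B)"
proof -
  note closed = assms imat_mult_colfin to_model_colfin from_model_colfin
  have "imat_mult (conjugate A) (conjugate B)
      = imat_mult from_model (imat_mult A (imat_mult (imat_mult to_model from_model) (imat_mult B to_model)))"
    unfolding conjugate_def by (simp add: imat_mult_assoc closed)
  then show ?thesis
    by (simp add: to_from_model imat_one_mult conjugate_def imat_mult_assoc closed)
qed

lemma conjugate_one: "conjugate imat_one = imat_one"
  by (simp add: conjugate_def imat_one_mult to_model_colfin from_to_model)

lemma conjugate_lift_T: "conjugate (lift T_fps) = divisor_matrix"
proof -
  have "conjugate (lift T_fps) = imat_mult (imat_mult from_model to_model) divisor_matrix"
    by (simp add: conjugate_def imat_mult_assoc to_model_colfin divisor_matrix_colfin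
        flip: to_model_divisor)
  then show ?thesis by (simp add: from_to_model imat_one_mult divisor_matrix_colfin)
qed

lemma conjugate_int_poly: "A \<in> int_poly_mats \<Longrightarrow> conjugate A \<in> int_poly_mats"
  unfolding conjugate_def by (intro imat_mult_int_poly from_model_int_poly to_model_int_poly)

lemma coords_conjugate:
  assumes "A \<in> colfin" "v \<in> Espace"
  shows "coords (imat_act (conjugate A) v) = imat_act A (coords v)"
proof -
  have "imat_act (conjugate A) v = imat_act from_model (imat_act A (coords v))"
    unfolding conjugate_def coords_def
    by (simp add: imat_act_assoc imat_mult_colfin assms to_model_colfin imat_act_in_Espace)
  then show ?thesis
    by (simp add: coords_from_model imat_act_in_Espace coords_in_Espace assms)
qed

text \<open>The span of the first \<open>i\<close> blocks in model coordinates. The inequality is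
  strict so that stage 0 is zero.\<close>

definition filtration :: "nat \<Rightarrow> ivec set" where
  "filtration i = {v \<in> Espace. \<forall>k. coords v k \<noteq> 0 \<longrightarrow> base k < enumerate bases i}"

lemma coords_nonzero_pos: "v \<in> Espace \<Longrightarrow> coords v k \<noteq> 0 \<Longrightarrow> 0 < k"
  using EspaceD(1)[OF coords_in_Espace] by (auto intro!: gr0I)

lemma filtration_zero: "(\<lambda>n. 0) \<in> filtration i"
  by (simp add: filtration_def Espace_closed coords_def imat_act_zero)

lemma filtration_0: "filtration 0 = {\<lambda>n. 0}"
proof (intro equalityI subsetI)
  fix v assume v: "v \<in> filtration 0"
  then have vE: "v \<in> Espace" by (simp add: filtration_def)
  have "1 \<in> bases" using base_in_bases[of 1] by (simp add: base_def odd_part_def level_def)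
  then have "enumerate bases 0 \<le> 1" by (simp add: enumerate_0 Least_le)
  then have "coords v k = 0" for k
    using v base_in_bases[of k] coords_nonzero_pos[OF vE, of k] by (force simp: filtration_def bases_def)
  then have "coords v = (\<lambda>n. 0)" by blast
  then show "v \<in> {\<lambda>n. 0}" using from_model_coords[OF vE] by (simp add: imat_act_zero)
next
  fix v :: ivec assume "v \<in> {\<lambda>n. 0}"
  then show "v \<in> filtration 0" using filtration_zero by simp
qed

lemma filtration_mono: "filtration i \<subseteq> filtration (Suc i)"
  using enumerate_step[OF infinite_bases, of i] by (force simp: filtration_def)

lemma filtration_exhausts: "(\<Union>i. filtration i) = Espace"
proof (intro equalityI subsetI)
  fix v assume v: "v \<in> Espace"
  let ?K = "{k. coords v k \<noteq> 0}"
  let ?N = "Suc (\<Sum>k\<in>?K. base k)"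
  have "base k < enumerate bases ?N" if "coords v k \<noteq> 0" for k
  proof -
    have "base k \<le> (\<Sum>k\<in>?K. base k)"
      using EspaceD(2)[OF coords_in_Espace[OF v]] that by (intro member_le_sum) auto
    also have "\<dots> < enumerate bases ?N" using le_enumerate[OF infinite_bases, of ?N] by simp
    finally show ?thesis .
  qed
  then show "v \<in> (\<Union>i. filtration i)" using v by (auto simp: filtration_def)
qed (auto simp: filtration_def)

lemma filtration_closed:
  "u \<in> filtration i \<Longrightarrow> v \<in> filtration i \<Longrightarrow> (\<lambda>n. u n + v n) \<in> filtration i"
  "v \<in> filtration i \<Longrightarrow> (\<lambda>n. a * v n) \<in> filtration i"
  by (auto simp: filtration_def Espace_closed coords_def imat_act_add imat_act_scale)
     (metis add.right_neutral)

lemma filtration_conjugate_lift: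
  assumes "lift M \<in> colfin" "v \<in> filtration i"
  shows "imat_act (conjugate (lift M)) v \<in> filtration i"
proof -
  have v: "v \<in> Espace" using assms by (simp add: filtration_def)
  have "conjugate (lift M) \<in> colfin"
    unfolding conjugate_def by (intro imat_mult_colfin from_model_colfin to_model_colfin assms)
  moreover have "base k < enumerate bases i" if nz: "imat_act (lift M) (coords v) k \<noteq> 0" for k
  proof -
    obtain j where "lift M k j \<noteq> 0" "coords v j \<noteq> 0" using imat_act_nonzero[OF nz] by blast
    then show ?thesis using base_lift_mono[of M k j] assms(2) by (force simp: filtration_def)
  qed
  ultimately show ?thesis
    using v by (simp add: filtration_def imat_act_in_Espace coords_conjugate assms)
qed

text \<open>The quotient map reads off the two coordinates in the newly added block. Inside one
  block a lifted matrix acts by its constant coefficients, which are the entries of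
  \<open>Y\<close>.\<close>

lemma filtration_quotient:
  assumes lift: "\<And>Y. Y \<in> SL2Z \<Longrightarrow> lift (M Y) \<in> colfin"
    and const: "\<And>Y a b. Y \<in> SL2Z \<Longrightarrow> fps_nth (vec_nth (vec_nth (M Y) a) b) 0 = vec_nth (vec_nth Y a) b"
  shows "quotient_is_standard (\<lambda>Y. conjugate (lift (M Y))) (filtration (Suc i)) (filtration i)"
proof -
  define e where "e = enumerate bases i"
  define m where "m = odd_part e"
  define c where "c = level e"
  have e: "0 < e" "slot e = 1"
    using enumerate_in_set[OF infinite_bases, of i] by (auto simp: bases_def e_def)
  have m: "odd m" using odd_odd_part[OF e(1)] by (simp add: m_def)
  have e_eq: "e = position m c 1" using position_collapse[OF e(1)] e by (simp add: m_def c_def)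
  define \<phi> :: "ivec \<Rightarrow> complex^2" where "\<phi> v = (\<chi> a. coords v (position m c a))" for v
  have inE: "v \<in> Espace" if "v \<in> filtration j" for v j using that by (simp add: filtration_def)
  have le_e: "base k \<le> e" if "v \<in> filtration (Suc i)" "coords v k \<noteq> 0" for v k
    using that base_less_enumerate_Suc[of k i] coords_nonzero_pos[OF inE[OF that(1)] that(2)]
    by (simp add: filtration_def e_def)
  have "\<phi> (\<lambda>n. u n + v n) = \<phi> u + \<phi> v" if "u \<in> filtration (Suc i)" "v \<in> filtration (Suc i)" for u v
    using that inE by (simp add: \<phi>_def vec_eq_iff coords_def imat_act_add)
  moreover have "\<phi> (\<lambda>n. a * v n) = a *s \<phi> v" for a v
    by (simp add: \<phi>_def vec_eq_iff coords_def imat_act_scale)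
  moreover have "\<phi> ` filtration (Suc i) = UNIV"
  proof (intro equalityI subsetI)
    fix w :: "complex^2"
    define u where "u k = (if 0 < k \<and> base k = e then w $ slot k else 0)" for k
    have supp: "k \<in> range (position m c)" if "u k \<noteq> 0" for k
      using that base_eqD[OF m, of k c] e_eq by (auto simp: u_def split: if_splits)
    then have "finite {k. u k \<noteq> 0}" using finite_subset[of "{k. u k \<noteq> 0}" "range (position m c)"] by auto
    then have u: "u \<in> Espace" by (simp add: Espace_def u_def)
    have "imat_act from_model u \<in> filtration (Suc i)"
      using u enumerate_step[OF infinite_bases, of i]
      by (auto simp: filtration_def imat_act_in_Espace from_model_colfin coords_from_model u_def e_def split: if_splits)
    moreover have "\<phi> (imat_act from_model u) = w"
      using m by (simp add: \<phi>_def vec_eq_iff coords_from_model u) (simp add: u_def position_pos base_position slot_position e_eq)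
    ultimately show "w \<in> \<phi> ` filtration (Suc i)" by force
  qed simp
  moreover have "{v \<in> filtration (Suc i). \<phi> v = 0} = filtration i"
  proof (intro equalityI subsetI)
    fix v assume v: "v \<in> {v \<in> filtration (Suc i). \<phi> v = 0}"
    have "base k < e" if nz: "coords v k \<noteq> 0" for k
    proof -
      have "base k \<noteq> e"
      proof
        assume "base k = e"
        then have "k = position m c (slot k)"
          using base_eqD[OF m, of k c] coords_nonzero_pos[OF inE, of v "Suc i" k] v nz e_eq by auto
        moreover have "coords v (position m c (slot k)) = 0"
          using v by (auto simp: \<phi>_def vec_eq_iff)
        ultimately show False using nz by simp
      qed
      then show ?thesis using le_e[of v k] v nz by simp
    qed
    then show "v \<in> filtration i" using v by (auto simp: filtration_def e_def)
  next
    fix v assume v: "v \<in> filtration i"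
    have "coords v (position m c a) = 0" for a
      using v m by (auto simp: filtration_def base_position simp flip: e_eq e_def)
    then show "v \<in> {v \<in> filtration (Suc i). \<phi> v = 0}"
      using v filtration_mono by (auto simp: \<phi>_def vec_eq_iff)
  qed
  moreover have "\<phi> (imat_act (conjugate (lift (M Y))) v) = cmat Y *v \<phi> v"
    if Y: "Y \<in> SL2Z" and v: "v \<in> filtration (Suc i)" for Y v
  proof -
    have "imat_act (lift (M Y)) (coords v) (position m c a) = (\<Sum>b\<in>UNIV. of_int (Y $ a $ b) * coords v (position m c b))" for a
    proof -
      let ?f = "\<lambda>k. lift (M Y) (position m c a) k * coords v k"
      let ?K = "{k. coords v k \<noteq> 0} \<union> range (position m c)"
      have K: "finite ?K" using EspaceD(2)[OF coords_in_Espace[OF inE[OF v]]] by simp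
      \<comment> \<open>An index feeding into the block has base at least \<open>e\<close> by
        \<open>base_lift_mono\<close> and at most \<open>e\<close> by \<open>le_e\<close>, so it
        lies in the block.\<close>
      have zero: "?f k = 0" if "k \<notin> range (position m c)" for k
      proof (rule ccontr)
        assume *: "?f k \<noteq> 0"
        then have "base k = e"
          using base_lift_mono[of "M Y" "position m c a" k] le_e[OF v, of k] m
          by (auto simp: base_position simp flip: e_eq)
        then show False using base_eqD[OF m, of k c] lift_nonzeroD(2)[of "M Y" _ k] * that e_eq by auto
      qed
      have inj: "inj (position m c)"
        by (rule inj_on_inverseI[where g = slot]) (simp add: slot_position m)
      have "imat_act (lift (M Y)) (coords v) (position m c a) = sum ?f ?K"
        using K by (intro imat_act_eq_sum) auto
      also have "\<dots> = sum ?f (range (position m c))"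
        using K zero by (intro sum.mono_neutral_right) blast+
      also have "\<dots> = (\<Sum>b\<in>UNIV. ?f (position m c b))"
        by (simp add: sum.reindex[OF inj])
      also have "\<dots> = (\<Sum>b\<in>UNIV. of_int (Y $ a $ b) * coords v (position m c b))"
        using m Y by (simp add: lift_def position_pos odd_part_position level_position slot_position const)
      finally show ?thesis .
    qed
    then show ?thesis
      by (simp add: \<phi>_def vec_eq_iff coords_conjugate lift Y inE[OF v] matrix_vector_mult_def cmat_def)
  qed
  ultimately show ?thesis
    unfolding quotient_is_standard_def using filtration_mono by blast
qed

section \<open>Assembly of the representation\<close>

lemma SL2Z_generators: "Smat \<in> SL2Z" "Umat \<in> SL2Z" "Tmat \<in> SL2Z"
  by (simp_all add: SL2Z_def det_2 Tmat_eq)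

theorem theorem3p1:
  "\<exists>\<rho> :: int^2^2 \<Rightarrow> imat.
     (\<forall>Y\<in>SL2Z. \<rho> Y \<in> colfin_units) \<and>
     (\<forall>X\<in>SL2Z. \<forall>Y\<in>SL2Z. \<rho> (X ** Y) = imat_mult (\<rho> X) (\<rho> Y)) \<and>
     (\<exists>F :: nat \<Rightarrow> ivec set.
        F 0 = {\<lambda>n. 0} \<and> (\<forall>i. F i \<subseteq> F (Suc i)) \<and> (\<Union>i. F i) = Espace \<and>
        (\<forall>i. submodule \<rho> (F i)) \<and>
        (\<forall>i\<ge>1. quotient_is_standard \<rho> (F i) (F (i - 1)))) \<and>
     \<rho> Tmat = divisor_matrix \<and>
     (\<forall>Y\<in>SL2Z. \<forall>i j. \<rho> Y i j \<in> \<int>) \<and>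
     (\<forall>Y\<in>SL2Z. \<rho> Y \<in> DR0)"
proof -
  interpret modular_relations S_fps "S_fps ** T_fps"
    by standard (rule S_fps_square, rule ST_fps_cube)
  obtain M where M_mult: "\<And>X Y. X \<in> SL2Z \<Longrightarrow> Y \<in> SL2Z \<Longrightarrow> M (X ** Y) = M X ** M Y"
    and M_one: "M (mat 1) = mat 1" and M_S: "M Smat = S_fps" and M_U: "M Umat = S_fps ** T_fps"
    using SL2Z_representation by blast
  \<comment> \<open>\<open>M\<close> is prescribed on \<open>S\<close> and \<open>U = S T\<close>;
    cancelling \<open>S\<close> gives its value at \<open>T\<close>.\<close>
  have "Smat ** Tmat = Umat" by (simp add: mat2_simps Tmat_eq)
  then have "S_fps ** M Tmat = S_fps ** T_fps"
    using M_mult[OF SL2Z_generators(1,3)] M_S M_U by simp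
  then have M_T: "M Tmat = T_fps" using ss_mult[of "M Tmat"] ss_mult[of T_fps] by simp
  \<comment> \<open>Coefficient bounds are needed for the generators only, since
    \<open>int_poly_mats\<close> is closed under products.\<close>
  have int_poly: "lift (M Y) \<in> int_poly_mats" if "Y \<in> SL2Z" for Y
    using that
  proof (induction rule: SL2Z_induct)
    case one
    show ?case by (simp add: M_one lift_one imat_one_int_poly)
  next
    case (S Y)
    then show ?case
      by (simp add: M_mult SL2Z_generators M_S imat_mult_int_poly lift_S_int_poly flip: lift_mult)
  next
    case (U Y)
    then show ?case
      by (simp add: M_mult SL2Z_generators M_U imat_mult_int_poly lift_S_int_poly lift_T_int_poly flip: lift_mult)
  qed
  note colfin = int_poly_mats_colfin[OF int_poly]
  \<comment> \<open>Reduction modulo \<open>y\<close> is multiplicative and sends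
    \<open>S_fps\<close> and \<open>T_fps\<close> to \<open>S\<close> and \<open>T\<close>, as the
    Catalan series has constant term 1.\<close>
  have const: "fps_nth (vec_nth (vec_nth (M Y) a) b) 0 = vec_nth (vec_nth Y a) b" if "Y \<in> SL2Z" for Y a b
    using that
  proof (induction arbitrary: a b rule: SL2Z_induct)
    case one
    show ?case using exhaust_2[of a] exhaust_2[of b] by (auto simp: M_one mat_1_2_nth)
  next
    case (S Y)
    then show ?case using exhaust_2[of a]
      by (auto simp: M_mult SL2Z_generators M_S matrix_mult_2_nth S_fps_def catalan_fps_def)
  next
    case (U Y)
    then show ?case using exhaust_2[of a]
      by (auto simp: M_mult SL2Z_generators M_U matrix_mult_2_nth S_fps_def T_fps_def catalan_fps_def)
  qed
  define \<rho> where "\<rho> Y = conjugate (lift (M Y))" for Y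
  have \<rho>_mult: "\<rho> (X ** Y) = imat_mult (\<rho> X) (\<rho> Y)" if "X \<in> SL2Z" "Y \<in> SL2Z" for X Y
    using that by (simp add: \<rho>_def M_mult conjugate_mult colfin lift_mult)
  have \<rho>_one: "\<rho> (mat 1) = imat_one" by (simp add: \<rho>_def M_one lift_one conjugate_one)
  have \<rho>_int_poly: "\<rho> Y \<in> int_poly_mats" if "Y \<in> SL2Z" for Y
    unfolding \<rho>_def by (intro conjugate_int_poly int_poly that)
  have units: "\<rho> Y \<in> colfin_units" if Y: "Y \<in> SL2Z" for Y
  proof -
    define Y' where "Y' = mat2 (Y$2$2) (- Y$1$2) (- Y$2$1) (Y$1$1)"
    have det: "Y$1$1 * Y$2$2 - Y$1$2 * Y$2$1 = 1" using Y by (simp add: SL2Z_def det_2)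
    then have Y': "Y' \<in> SL2Z" "Y ** Y' = mat 1" "Y' ** Y = mat 1"
      by (simp_all add: Y'_def SL2Z_def det_2 mat2_simps algebra_simps)
    then have "imat_mult (\<rho> Y) (\<rho> Y') = imat_one" "imat_mult (\<rho> Y') (\<rho> Y) = imat_one"
      using \<rho>_mult[OF Y Y'(1)] \<rho>_mult[OF Y'(1) Y] \<rho>_one by simp_all
    then show ?thesis
      using int_poly_mats_colfin[OF \<rho>_int_poly] Y Y'(1) by (auto simp: colfin_units_def)
  qed
  have submod: "submodule \<rho> (filtration i)" for i
  proof -
    have "filtration i \<subseteq> Espace" by (auto simp: filtration_def)
    then show ?thesis
      unfolding submodule_def \<rho>_def
      using filtration_closed filtration_zero filtration_conjugate_lift[OF colfin] by blast
  qed
  have quot: "quotient_is_standard \<rho> (filtration i) (filtration (i - 1))" if "i \<ge> 1" for i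
    using filtration_quotient[of M "i - 1", OF colfin const] that by (simp add: \<rho>_def[abs_def])
  have "\<rho> Tmat = divisor_matrix" by (simp add: \<rho>_def M_T conjugate_lift_T)
  then show ?thesis
    using units \<rho>_mult submod quot \<rho>_int_poly int_poly_mats_Ints int_poly_mats_DR0
      filtration_0 filtration_mono filtration_exhausts
    by (intro exI[of _ \<rho>] conjI exI[of _ filtration]) blast+
qed

end
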